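(* Suppose $f\colon\Gamma\to\Gamma$ satisfies the chain flare condition relative to the $f$-invariant subgraph $H$. Then there is a constant $\lambda>1$ such that for every $1\le\nu<\lambda$, $$W^{(2)}_{\rm qf}=\mathfrak{E}(L_{f,H},\nu)\cap\mathfrak{F}(L_{f,H},\nu^{-1}).$$
   Context: Setup: $\mathbb{F}$ finitely generated free, $\Gamma$ a finite connected graph with $\pi_1(\Gamma)\cong\mathbb{F}$, $f$ a homotopy equivalence, cellular and edge-linear, $H\subset\Gamma$ a subgraph with $f(H)\subseteq H$, $\widetilde\Gamma$ the universal cover with deck action of $\mathbb{F}$, $\widetilde H$ the preimage of $H$, $\tilde f$ a fixed lift with $\tilde f(gz)=\Phi_f(g)\tilde f(z)$. $A_{f,H}$: on rational 1-chains of $\widetilde\Gamma$ vanishing on edges of $\widetilde H$, apply the chain map induced by $\tilde f$ and set coefficients on edges of $\widetilde H$ to $0$; it extends to a bounded operator on square-summable complex chains supported off $\widetilde H$, identified with $L^2(\mathbb F)^{n_H}$. Nielsen 1-chain: $\rho=\pi_H^\perp([u,v])$ ($[u,v]$ the chain of the reduced edge-path between vertices $u,v$ fixed by $\tilde f$), non-geometric (some edge $e\notin\widetilde H$ has $\rho_e=\pm1$ and $\rho_{ge}=0$ for $g\ne1$) or geometric (distinct translates' supports share at most one edge; each edge off $\widetilde H$ is the unique common edge of exactly two translates' supports; the support of $\rho$ meets those of $g_1\rho,g_2\rho$ for some non-commuting $g_1,g_2$). Chain flare condition relative to $H$: $\mathbb Q[\mathbb F]$-submodules $V_{\rm h},V_{\rm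 qf}$ with (CFH1) $V_{\rm h}+V_{\rm qf}$ equal to all relative rational chains; (CFH2) $\lambda_0>1,0<\theta<1$ with $\lambda_0\|A_{f,H}x\|\le\max\{\|A^2_{f,H}x\|,\|x\|\}$ for all $x\in N_\theta(V_{\rm h})^\infty$, where $N_\theta(V)=\{x':\langle x,x'\rangle>\theta\|x\|\|x'\|\text{ for some }x\in V\}$ and $N^\infty$ is the set of $x'$ with $x'=A^k_{f,H}(x)$, $x\in N,k\ge0$, or $A^k_{f,H}(x')\in N$, $k\ge0$; (CFH3) if $V_{\rm qf}\ne0$, every $x\in V_{\rm qf}$ is $\sum_jq_jg_j\rho$ for a fixed Nielsen 1-chain $\rho$. $V^{(2)}_{\rm qf}$: closure of the complex span of $V_{\rm qf}$. $G_\phi=\mathbb F\rtimes_{\Phi_f}\langle t\rangle$; each $\xi\in L^2(G_\phi)^{n_H}$ is uniquely $\sum_\ell t^\ell\xi^{(\ell)}$, $\xi^{(\ell)}\in L^2(\mathbb F)^{n_H}$; $L_{f,H}(\xi)=\sum_\ell t^{\ell+1}A_{f,H}(\xi^{(\ell)})$; $W^{(2)}_{\rm qf}$ is the closure of $\sum_\ell t^\ell V^{(2)}_{\rm qf}$. For a bounded operator $A$ and $\nu>0$: $\mathfrak{E}(A,\nu)=\{\xi:\exists(\xi_j),\ \|\xi_j-\xi\|\to0,\ \limsup_j\|A^j\xi_j\|^{1/j}\le\nu\}$, $\mathfrak{F}(A,\nu)=\{\xi:\exists(\xi_j),\ \|A^j\xi_j-\xi\|\to0,\ \limsup_j\|\xi_j\|^{1/j}\le\nu^{-1}\}$.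 *)

theory Defs
  imports "HOL-Analysis.Analysis"
begin

text \<open>An oriented edge step is a pair (e, d): d = True traverses e from its
source to its target, d = False traverses it backwards.\<close>

type_synonym 'e epath = "('e \<times> bool) list"

record ('v, 'e) gsetup =
  gV :: "'v set"
  gE :: "'e set"
  gsrc :: "'e \<Rightarrow> 'v"
  gtgt :: "'e \<Rightarrow> 'v"
  gbase :: "'v"
  gHV :: "'v set"
  gHE :: "'e set"
  gfV :: "'v \<Rightarrow> 'v"
  gfE :: "'e \<Rightarrow> 'e epath"
  glift :: "'e epath"     \<comment> \<open>reduced path from base to f(base): determines the lift of f\<close>

fun gpath :: "('v,'e) gsetup \<Rightarrow> 'v \<Rightarrow> 'e epath \<Rightarrow> 'v \<Rightarrow> bool" where
  "gpath S a [] b = (a \<in> gV S \<and> a = b)"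
| "gpath S a ((e, d) # p) b =
     (e \<in> gE S \<and> (if d then gsrc S e = a \<and> gpath S (gtgt S e) p b
                          else gtgt S e = a \<and> gpath S (gsrc S e) p b))"

definition reduced_path :: "'e epath \<Rightarrow> bool" where
  "reduced_path p \<longleftrightarrow>
     (\<forall>i. Suc i < length p \<longrightarrow> \<not> (fst (p ! i) = fst (p ! Suc i) \<and> snd (p ! i) \<noteq> snd (p ! Suc i)))"

definition cancel_step :: "'e \<times> bool \<Rightarrow> 'e epath \<Rightarrow> 'e epath" where
  "cancel_step x acc = (case acc of [] \<Rightarrow> [x]
      | y # r \<Rightarrow> if fst y = fst x \<and> snd y \<noteq> snd x then r else x # acc)"

definition reduce :: "'e epath \<Rightarrow> 'e epath" where
  "reduce p = foldr cancel_step p []"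

definition pinv :: "'e epath \<Rightarrow> 'e epath" where
  "pinv p = rev (map (\<lambda>(e, d). (e, \<not> d)) p)"

text \<open>Vertices of the universal cover: reduced edge paths starting at the base vertex.
Edges of the universal cover: pairs (p, e) with p a cover vertex ending at the source of e;
this edge goes from p to reduce (p @ [(e,True)]).\<close>

definition cverts :: "('v,'e) gsetup \<Rightarrow> 'e epath set" where
  "cverts S = {p. reduced_path p \<and> (\<exists>b. gpath S (gbase S) p b)}"

definition cedges :: "('v,'e) gsetup \<Rightarrow> ('e epath \<times> 'e) set" where
  "cedges S = {(p, e). p \<in> cverts S \<and> e \<in> gE S \<and> gpath S (gbase S) p (gsrc S e)}"

definition Hedges_t :: "('v,'e) gsetup \<Rightarrow> ('e epath \<times> 'e) set" where
  "Hedges_t S = {(p, e). (p, e) \<in> cedges S \<and> e \<in> gHE S}"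

definition Eoff :: "('v,'e) gsetup \<Rightarrow> ('e epath \<times> 'e) set" where
  "Eoff S = cedges S - Hedges_t S"

text \<open>The group F = pi_1(Gamma, base): reduced closed paths, product = reduced concatenation,
identity = [], inverse = pinv.\<close>
definition pi1 :: "('v,'e) gsetup \<Rightarrow> 'e epath set" where
  "pi1 S = {g. reduced_path g \<and> gpath S (gbase S) g (gbase S)}"

definition gmult :: "'e epath \<Rightarrow> 'e epath \<Rightarrow> 'e epath" where
  "gmult g h = reduce (g @ h)"

definition deck :: "'e epath \<Rightarrow> 'e epath \<times> 'e \<Rightarrow> 'e epath \<times> 'e" where
  "deck g a = (reduce (g @ fst a), snd a)"

definition fpath :: "('v,'e) gsetup \<Rightarrow> 'e epath \<Rightarrow> 'e epath" where
  "fpath S p = concat (map (\<lambda>(e, d). if d then gfE S e else pinv (gfE S e)) p)"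

text \<open>Phi_f, the automorphism of F induced by f and the chosen lift.\<close>
definition Phi :: "('v,'e) gsetup \<Rightarrow> 'e epath \<Rightarrow> 'e epath" where
  "Phi S g = reduce (glift S @ fpath S g @ pinv (glift S))"

definition ftil :: "('v,'e) gsetup \<Rightarrow> 'e epath \<Rightarrow> 'e epath" where
  "ftil S p = reduce (glift S @ fpath S p)"

text \<open>Integral 1-chain of the lift, starting at cover vertex q, of an edge path s.\<close>
fun liftchain :: "'e epath \<Rightarrow> 'e epath \<Rightarrow> ('e epath \<times> 'e \<Rightarrow> int)" where
  "liftchain q [] = (\<lambda>_. 0)"
| "liftchain q ((e, d) # s) =
     (if d then (\<lambda>x. (if x = (q, e) then 1 else 0) + liftchain (reduce (q @ [(e, True)])) s x)
      else (let q' = reduce (q @ [(e, False)]) in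
            (\<lambda>x. (if x = (q', e) then -1 else 0) + liftchain q' s x)))"

definition chmap :: "('v,'e) gsetup \<Rightarrow> 'e epath \<times> 'e \<Rightarrow> ('e epath \<times> 'e \<Rightarrow> int)" where
  "chmap S a = liftchain (ftil S (fst a)) (gfE S (snd a))"

definition l2 :: "'a set \<Rightarrow> ('a \<Rightarrow> complex) set" where
  "l2 D = {x. (\<forall>a. a \<notin> D \<longrightarrow> x a = 0) \<and> (\<lambda>a. (cmod (x a))^2) summable_on UNIV}"

definition nrm :: "('a \<Rightarrow> complex) \<Rightarrow> real" where
  "nrm x = sqrt (\<Sum>\<^sub>\<infinity>a. (cmod (x a))^2)"

definition cinner :: "('a \<Rightarrow> complex) \<Rightarrow> ('a \<Rightarrow> complex) \<Rightarrow> complex" where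
  "cinner x y = (\<Sum>\<^sub>\<infinity>a. x a * cnj (y a))"

definition lclosure :: "'a set \<Rightarrow> ('a \<Rightarrow> complex) set \<Rightarrow> ('a \<Rightarrow> complex) set" where
  "lclosure D X = {y \<in> l2 D. \<exists>s. (\<forall>n. s n \<in> X) \<and> (\<lambda>n. nrm (\<lambda>a. s n a - y a)) \<longlonglongrightarrow> 0}"

definition cxspan :: "('a \<Rightarrow> complex) set \<Rightarrow> ('a \<Rightarrow> complex) set" where
  "cxspan X = {(\<lambda>a. \<Sum>i<n. c i * v i a) | (n::nat) c v. \<forall>i<n. v i \<in> X}"

definition Aop :: "('v,'e) gsetup \<Rightarrow> ('e epath \<times> 'e \<Rightarrow> complex) \<Rightarrow> ('e epath \<times> 'e \<Rightarrow> complex)" where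
  "Aop S x = (\<lambda>b. if b \<in> Eoff S
       then (\<Sum>\<^sub>\<infinity>a\<in>Eoff S. x a * of_int (chmap S a b)) else 0)"

text \<open>L^2(G_phi)^{n_H} is identified with square-summable functions on Z x (edges off the
preimage of H): xi(l, -) is the component xi^(l).  L_{f,H} sends xi to the element whose
(l+1)-component is A_{f,H}(xi^(l)).\<close>
definition Lop :: "('v,'e) gsetup \<Rightarrow> (int \<times> ('e epath \<times> 'e) \<Rightarrow> complex) \<Rightarrow> (int \<times> ('e epath \<times> 'e) \<Rightarrow> complex)" where
  "Lop S xi = (\<lambda>(l, b). Aop S (\<lambda>a. xi (l - 1, a)) b)"

definition frakE :: "'a set \<Rightarrow> (('a \<Rightarrow> complex) \<Rightarrow> ('a \<Rightarrow> complex)) \<Rightarrow> real \<Rightarrow> ('a \<Rightarrow> complex) set" where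
  "frakE D A \<nu> = {xi \<in> l2 D. \<exists>s. (\<forall>j. s j \<in> l2 D) \<and>
       (\<lambda>j. nrm (\<lambda>a. s j a - xi a)) \<longlonglongrightarrow> 0 \<and>
       limsup (\<lambda>j. ereal (root j (nrm ((A ^^ j) (s j))))) \<le> ereal \<nu>}"

definition frakF :: "'a set \<Rightarrow> (('a \<Rightarrow> complex) \<Rightarrow> ('a \<Rightarrow> complex)) \<Rightarrow> real \<Rightarrow> ('a \<Rightarrow> complex) set" where
  "frakF D A \<nu> = {xi \<in> l2 D. \<exists>s. (\<forall>j. s j \<in> l2 D) \<and>
       (\<lambda>j. nrm (\<lambda>a. (A ^^ j) (s j) a - xi a)) \<longlonglongrightarrow> 0 \<and>
       limsup (\<lambda>j. ereal (root j (nrm (s j)))) \<le> ereal (inverse \<nu>)}"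

definition rchains :: "('v,'e) gsetup \<Rightarrow> ('e epath \<times> 'e \<Rightarrow> rat) set" where
  "rchains S = {x. finite {a. x a \<noteq> 0} \<and> (\<forall>a. a \<notin> Eoff S \<longrightarrow> x a = 0)}"

definition emb :: "('a \<Rightarrow> rat) \<Rightarrow> ('a \<Rightarrow> complex)" where
  "emb x = (\<lambda>a. of_rat (x a))"

definition gact :: "('v,'e) gsetup \<Rightarrow> 'e epath \<Rightarrow> ('e epath \<times> 'e \<Rightarrow> 'b::zero) \<Rightarrow> ('e epath \<times> 'e \<Rightarrow> 'b)" where
  "gact S g x = (\<lambda>a. if a \<in> cedges S then x (deck (pinv g) a) else 0)"

definition qmodule :: "('v,'e) gsetup \<Rightarrow> ('e epath \<times> 'e \<Rightarrow> rat) set \<Rightarrow> bool" where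
  "qmodule S W \<longleftrightarrow> W \<subseteq> rchains S \<and> (\<lambda>_. 0) \<in> W
     \<and> (\<forall>x\<in>W. \<forall>y\<in>W. (\<lambda>a. x a + y a) \<in> W)
     \<and> (\<forall>q. \<forall>x\<in>W. (\<lambda>a. q * x a) \<in> W)
     \<and> (\<forall>g\<in>pi1 S. \<forall>x\<in>W. gact S g x \<in> W)"

definition csupp :: "('a \<Rightarrow> 'b::zero) \<Rightarrow> 'a set" where
  "csupp x = {a. x a \<noteq> 0}"

definition translates :: "('v,'e) gsetup \<Rightarrow> ('e epath \<times> 'e \<Rightarrow> rat) \<Rightarrow> ('e epath \<times> 'e \<Rightarrow> rat) set" where
  "translates S \<rho> = {gact S g \<rho> | g. g \<in> pi1 S}"

definition nongeometric :: "('v,'e) gsetup \<Rightarrow> ('e epath \<times> 'e \<Rightarrow> rat) \<Rightarrow> bool" where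
  "nongeometric S \<rho> \<longleftrightarrow> (\<exists>e\<in>Eoff S. (\<rho> e = 1 \<or> \<rho> e = -1) \<and>
       (\<forall>g\<in>pi1 S. g \<noteq> [] \<longrightarrow> \<rho> (deck g e) = 0))"

definition geometric :: "('v,'e) gsetup \<Rightarrow> ('e epath \<times> 'e \<Rightarrow> rat) \<Rightarrow> bool" where
  "geometric S \<rho> \<longleftrightarrow>
     (\<forall>\<sigma>\<in>translates S \<rho>. \<forall>\<sigma>'\<in>translates S \<rho>. \<sigma> \<noteq> \<sigma>' \<longrightarrow>
        (\<forall>a b. a \<in> csupp \<sigma> \<inter> csupp \<sigma>' \<longrightarrow> b \<in> csupp \<sigma> \<inter> csupp \<sigma>' \<longrightarrow> a = b))
   \<and> (\<forall>e\<in>Eoff S. \<exists>\<sigma>1\<in>translates S \<rho>. \<exists>\<sigma>2\<in>translates S \<rho>. \<sigma>1 \<noteq> \<sigma>2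
        \<and> csupp \<sigma>1 \<inter> csupp \<sigma>2 = {e}
        \<and> (\<forall>\<sigma>\<in>translates S \<rho>. e \<in> csupp \<sigma> \<longrightarrow> \<sigma> = \<sigma>1 \<or> \<sigma> = \<sigma>2))
   \<and> (\<exists>g1\<in>pi1 S. \<exists>g2\<in>pi1 S. gmult g1 g2 \<noteq> gmult g2 g1
        \<and> csupp \<rho> \<inter> csupp (gact S g1 \<rho>) \<noteq> {} \<and> csupp \<rho> \<inter> csupp (gact S g2 \<rho>) \<noteq> {})"

definition nielsen :: "('v,'e) gsetup \<Rightarrow> ('e epath \<times> 'e \<Rightarrow> rat) \<Rightarrow> bool" where
  "nielsen S \<rho> \<longleftrightarrow> (\<exists>u\<in>cverts S. \<exists>v\<in>cverts S. ftil S u = u \<and> ftil S v = v \<and>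
       \<rho> = (\<lambda>a. if a \<in> Eoff S then of_int (liftchain u (reduce (pinv u @ v)) a) else 0))
     \<and> (nongeometric S \<rho> \<or> geometric S \<rho>)"

definition Ntheta :: "('v,'e) gsetup \<Rightarrow> real \<Rightarrow> ('e epath \<times> 'e \<Rightarrow> rat) set \<Rightarrow> ('e epath \<times> 'e \<Rightarrow> complex) set" where
  "Ntheta S \<theta> V = {x' \<in> l2 (Eoff S). \<exists>x\<in>V. Re (cinner (emb x) x') > \<theta> * nrm (emb x) * nrm x'}"

definition Ninf :: "('v,'e) gsetup \<Rightarrow> ('e epath \<times> 'e \<Rightarrow> complex) set \<Rightarrow> ('e epath \<times> 'e \<Rightarrow> complex) set" where
  "Ninf S N = {x' \<in> l2 (Eoff S). (\<exists>x\<in>N. \<exists>k. x' = (Aop S ^^ k) x) \<or> (\<exists>k. (Aop S ^^ k) x' \<in> N)}"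

definition chain_flare :: "('v,'e) gsetup \<Rightarrow> ('e epath \<times> 'e \<Rightarrow> rat) set \<Rightarrow> ('e epath \<times> 'e \<Rightarrow> rat) set \<Rightarrow> bool" where
  "chain_flare S Vh Vqf \<longleftrightarrow> qmodule S Vh \<and> qmodule S Vqf
   \<and> {(\<lambda>a. x a + y a) | x y. x \<in> Vh \<and> y \<in> Vqf} = rchains S
   \<and> (\<exists>lam0 \<theta>. lam0 > 1 \<and> 0 < \<theta> \<and> \<theta> < 1 \<and>
        (\<forall>x \<in> Ninf S (Ntheta S \<theta> Vh).
           lam0 * nrm (Aop S x) \<le> max (nrm (Aop S (Aop S x))) (nrm x)))
   \<and> (Vqf \<noteq> {\<lambda>_. 0} \<longrightarrow> (\<exists>\<rho>. nielsen S \<rho> \<and>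
        (\<forall>x\<in>Vqf. \<exists>(n::nat) q g. (\<forall>j<n. g j \<in> pi1 S) \<and> x = (\<lambda>a. \<Sum>j<n. q j * gact S (g j) \<rho> a))))"

definition Vqf2 :: "('v,'e) gsetup \<Rightarrow> ('e epath \<times> 'e \<Rightarrow> rat) set \<Rightarrow> ('e epath \<times> 'e \<Rightarrow> complex) set" where
  "Vqf2 S Vqf = lclosure (Eoff S) (cxspan (emb ` Vqf))"

text \<open>W_qf: closure of sum_l t^l V_qf^(2), inside the sequence model of L^2(G_phi)^{n_H}.\<close>
definition Wqf :: "('v,'e) gsetup \<Rightarrow> ('e epath \<times> 'e \<Rightarrow> rat) set \<Rightarrow> (int \<times> ('e epath \<times> 'e) \<Rightarrow> complex) set" where
  "Wqf S Vqf = lclosure (UNIV \<times> Eoff S)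
     {(\<lambda>(l, a). \<Sum>i<n. if l = k i then v i a else 0) | (n::nat) k v. \<forall>i<n. v i \<in> Vqf2 S Vqf}"

definition graph_ok :: "('v,'e) gsetup \<Rightarrow> bool" where
  "graph_ok S \<longleftrightarrow> finite (gV S) \<and> finite (gE S)
     \<and> (\<forall>e\<in>gE S. gsrc S e \<in> gV S \<and> gtgt S e \<in> gV S)
     \<and> gbase S \<in> gV S
     \<and> (\<forall>a\<in>gV S. \<forall>b\<in>gV S. \<exists>p. gpath S a p b)"

definition subgraph_ok :: "('v,'e) gsetup \<Rightarrow> bool" where
  "subgraph_ok S \<longleftrightarrow> gHV S \<subseteq> gV S \<and> gHE S \<subseteq> gE S
     \<and> (\<forall>e\<in>gHE S. gsrc S e \<in> gHV S \<and> gtgt S e \<in> gHV S)"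

definition cellular_map :: "('v,'e) gsetup \<Rightarrow> bool" where
  "cellular_map S \<longleftrightarrow> (\<forall>v\<in>gV S. gfV S v \<in> gV S)
     \<and> (\<forall>e\<in>gE S. gpath S (gfV S (gsrc S e)) (gfE S e) (gfV S (gtgt S e)))"

definition invariant_subgraph :: "('v,'e) gsetup \<Rightarrow> bool" where
  "invariant_subgraph S \<longleftrightarrow> (\<forall>v\<in>gHV S. gfV S v \<in> gHV S)
     \<and> (\<forall>e\<in>gHE S. fst ` set (gfE S e) \<subseteq> gHE S)"

definition lift_ok :: "('v,'e) gsetup \<Rightarrow> bool" where
  "lift_ok S \<longleftrightarrow> reduced_path (glift S) \<and> gpath S (gbase S) (glift S) (gfV S (gbase S))"

text \<open>f is a homotopy equivalence: for a map of connected graphs this means that the induced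
map on fundamental groups is an isomorphism.\<close>
definition homotopy_equiv :: "('v,'e) gsetup \<Rightarrow> bool" where
  "homotopy_equiv S \<longleftrightarrow> bij_betw (Phi S) (pi1 S) (pi1 S)"

end

theory Submission
  imports Defs
begin

text \<open>The constant is the flare factor. The operator \<^const>\<open>Lop\<close> acts as \<^const>\<open>Aop\<close> followed
by a shift of the levels, so a vector in the intersection of the two spectral spaces has level
components \<open>x\<close> that are limits of vectors \<open>s\<^sub>j\<close> with \<open>A\<^sup>j s\<^sub>j\<close> of size at most \<open>\<mu>\<^sup>j\<close>, and also limits of
vectors \<open>A\<^sup>j t\<^sub>j\<close> with \<open>t\<^sub>j\<close> of size at most \<open>\<mu>\<^sup>j\<close>, where \<open>\<mu>\<close> is smaller than the flare factor.

A Nielsen chain is fixed by \<open>A\<close> up to translation, so every quasi-fixed chain has bounded forward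
orbits and uniformly bounded preimages under all powers of \<open>A\<close>; a diagonal argument puts its closure
into the intersection. Conversely, suppose that \<open>x\<close> is real and not in the closure of the quasi-fixed
chains. Approximating \<open>x\<close> by a rational chain and splitting that chain, subtract a quasi-fixed chain
from \<open>x\<close> so that the difference \<open>y\<close> makes a small angle with a hyperbolic chain. Then the flare
inequality holds along the orbits of all vectors near \<open>y\<close>. Slow growth of the \<open>s\<^sub>j\<close> forces \<open>A\<close> to
shrink \<open>y\<close> by the flare factor, slow growth of the \<open>t\<^sub>j\<close> forces \<open>A\<close> to expand \<open>y\<close> by it: a
contradiction.\<close>

section \<open>Reduced words\<close>

definition linv :: "'e \<times> bool \<Rightarrow> 'e \<times> bool" where
  "linv x = (fst x, \<not> snd x)"

lemma linv_linv [simp]: "linv (linv x) = x"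
  by (simp add: linv_def)

lemma linv_Pair: "linv (e, d) = (e, \<not> d)"
  by (simp add: linv_def)

lemma cancel_step_Nil [simp]: "cancel_step x [] = [x]"
  by (simp add: cancel_step_def)

lemma cancel_step_Cons: "cancel_step x (y # r) = (if y = linv x then r else x # y # r)"
  by (auto simp: cancel_step_def linv_def prod_eq_iff)

lemma reduced_path_Nil [simp]: "reduced_path []"
  by (simp add: reduced_path_def)

lemma reduced_path_Cons:
  "reduced_path (x # p) \<longleftrightarrow> reduced_path p \<and> (p = [] \<or> hd p \<noteq> linv x)"
proof -
  have all_Suc: "(\<forall>i. Q i) \<longleftrightarrow> Q 0 \<and> (\<forall>i. Q (Suc i))" for Q :: "nat \<Rightarrow> bool"
    by (metis nat.exhaust)
  have "reduced_path (x # p) \<longleftrightarrow>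
     (Suc 0 < length (x # p) \<longrightarrow> \<not> (fst x = fst (p ! 0) \<and> snd x \<noteq> snd (p ! 0))) \<and> reduced_path p"
    unfolding reduced_path_def by (subst all_Suc) simp
  then show ?thesis
    by (cases p) (auto simp: linv_def prod_eq_iff)
qed

lemma reduced_cancel_step: "reduced_path p \<Longrightarrow> reduced_path (cancel_step x p)"
  by (cases p) (auto simp: cancel_step_Cons reduced_path_Cons)

text \<open>The delicate case is \<open>p\<close> starting with \<open>x\<close>: the inner step
  deletes this letter, and as \<open>p\<close> is reduced its tail does not start with
  \<open>linv x\<close>, so the outer step puts the letter back.\<close>

lemma cancel_step_cancel:
  assumes "reduced_path p"
  shows "cancel_step x (cancel_step (linv x) p) = p"
proof (cases p)
  case (Cons y r)
  with assms show ?thesis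
    by (cases r) (auto simp: cancel_step_Cons reduced_path_Cons)
qed (simp add: cancel_step_Cons)

lemma reduce_Nil [simp]: "reduce [] = []"
  by (simp add: reduce_def)

lemma reduce_Cons: "reduce (x # p) = cancel_step x (reduce p)"
  by (simp add: reduce_def)

lemma reduced_reduce [simp]: "reduced_path (reduce p)"
  by (induction p) (auto simp: reduce_Cons intro: reduced_cancel_step)

lemma reduce_reduced: "reduced_path p \<Longrightarrow> reduce p = p"
proof (induction p)
  case (Cons x p)
  then show ?case
    by (cases p) (auto simp: reduce_Cons reduced_path_Cons cancel_step_Cons)
qed simp

text \<open>A cancellation inside the left factor may be postponed until the right factor has been
  reduced. By induction \<open>reduce\<close> becomes compatible with concatenation on both sides,
  which is what makes reduced words behave like a group.\<close>

lemma reduce_cancel_step_append: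
  "reduce (cancel_step x p @ q) = cancel_step x (reduce (p @ q))"
  by (cases p) (auto simp: cancel_step_Cons reduce_Cons cancel_step_cancel)

lemma reduce_append_left [simp]: "reduce (reduce p @ q) = reduce (p @ q)"
  by (induction p) (simp_all add: reduce_Cons reduce_cancel_step_append)

lemma reduce_append_right [simp]: "reduce (p @ reduce q) = reduce (p @ q)"
  by (induction p) (simp_all add: reduce_Cons reduce_reduced)

lemma reduce_append_mid [simp]: "reduce (p @ reduce q @ r) = reduce (p @ q @ r)"
  by (metis reduce_append_left reduce_append_right)

lemma reduce_reduce [simp]: "reduce (reduce p) = reduce p"
  by (simp add: reduce_reduced)

lemma pinv_Nil [simp]: "pinv [] = []"
  by (simp add: pinv_def)

lemma pinv_Cons: "pinv (x # p) = pinv p @ [linv x]"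
  by (simp add: pinv_def linv_def split_beta)

lemma pinv_append: "pinv (p @ q) = pinv q @ pinv p"
  by (simp add: pinv_def)

lemma pinv_pinv [simp]: "pinv (pinv p) = p"
  by (induction p) (simp_all add: pinv_Cons pinv_append)

lemma reduce_pinv_cancel_right [simp]: "reduce (p @ pinv p @ q) = reduce q"
proof (induction p arbitrary: q)
  case (Cons x p)
  have "reduce ((x # p) @ pinv (x # p) @ q) = cancel_step x (reduce (p @ pinv p @ linv x # q))"
    by (simp add: reduce_Cons pinv_Cons)
  also have "\<dots> = reduce q"
    unfolding Cons.IH by (simp add: reduce_Cons cancel_step_cancel)
  finally show ?case .
qed simp

lemma reduce_pinv_cancel_left [simp]: "reduce (pinv p @ p @ q) = reduce q"
  using reduce_pinv_cancel_right[of "pinv p" q] by simp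

lemma reduce_pinv_cancel [simp]: "reduce (p @ pinv p) = []" "reduce (pinv p @ p) = []"
  using reduce_pinv_cancel_right[of p "[]"] reduce_pinv_cancel_left[of p "[]"] by simp_all

lemma reduce_pinv_cancel_mid [simp]:
  "reduce (q @ p @ pinv p @ r) = reduce (q @ r)"
  "reduce (q @ pinv p @ p @ r) = reduce (q @ r)"
  "reduce (q @ p @ pinv p) = reduce q"
  "reduce (q @ pinv p @ p) = reduce q"
  by (metis reduce_append_right reduce_pinv_cancel_right reduce_pinv_cancel_left
      append_Nil2 reduce_pinv_cancel)+

text \<open>The word \<open>q @ pinv q\<close> is inserted behind \<open>pinv (reduce q)\<close>;
  replacing this \<open>q\<close> by \<open>reduce q\<close> cancels the first two factors and
  leaves \<open>pinv q\<close>.\<close>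

lemma reduce_pinv_reduce [simp]: "reduce (p @ pinv (reduce q) @ r) = reduce (p @ pinv q @ r)"
proof -
  have "reduce (p @ pinv (reduce q) @ r) = reduce (p @ pinv (reduce q) @ q @ pinv q @ r)"
    by (metis reduce_append_right reduce_pinv_cancel_right)
  also have "\<dots> = reduce ((p @ pinv (reduce q)) @ reduce q @ (pinv q @ r))"
    by (subst reduce_append_mid) simp
  also have "\<dots> = reduce (p @ pinv q @ r)"
    by simp
  finally show ?thesis .
qed

lemma reduce_pinv_reduce_simps [simp]:
  "reduce (pinv (reduce q) @ r) = reduce (pinv q @ r)"
  "reduce (p @ pinv (reduce q)) = reduce (p @ pinv q)"
  "reduce (pinv (reduce q)) = reduce (pinv q)"
  using reduce_pinv_reduce[of "[]" q r] reduce_pinv_reduce[of p q "[]"]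
    reduce_pinv_reduce[of "[]" q "[]"] by simp_all

lemma reduce_append_cancel_left:
  assumes "reduced_path p" "reduced_path q"
  shows "reduce (g @ p) = reduce (g @ q) \<longleftrightarrow> p = q"
  by (metis assms reduce_append_right reduce_pinv_cancel_left reduce_reduced)

section \<open>The action of the map on words and on vertices of the universal cover\<close>

lemma fpath_Nil [simp]: "fpath S [] = []"
  by (simp add: fpath_def)

lemma fpath_append: "fpath S (p @ q) = fpath S p @ fpath S q"
  by (simp add: fpath_def)

lemma fpath_Cons: "fpath S (x # p) = (if snd x then gfE S (fst x) else pinv (gfE S (fst x))) @ fpath S p"
  by (simp add: fpath_def split_beta)

lemma fpath_linv_Cons: "fpath S (linv x # p) = pinv (fpath S [x]) @ fpath S p"
  by (simp add: fpath_Cons linv_def)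

lemma fpath_pinv: "fpath S (pinv p) = pinv (fpath S p)"
proof (induction p)
  case (Cons x p)
  then show ?case
    by (simp add: pinv_Cons fpath_append fpath_linv_Cons fpath_Cons[of _ x p] fpath_Cons[of _ x "[]"] pinv_append)
qed simp

text \<open>A cancelling pair of letters is sent to a word followed by its inverse, so up to
  reduction \<open>fpath\<close> is well defined on homotopy classes of paths.\<close>

lemma reduce_fpath_cancel_step:
  "reduce (p @ fpath S (cancel_step x acc) @ q) = reduce (p @ fpath S (x # acc) @ q)"
proof (cases acc)
  case (Cons y r)
  have "fpath S (x # linv x # r) = fpath S [x] @ pinv (fpath S [x]) @ fpath S r"
    by (metis append_Cons append_Nil fpath_append fpath_linv_Cons)
  then have "reduce (p @ fpath S (x # linv x # r) @ q) = reduce (p @ fpath S r @ q)"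
    by simp
  with Cons show ?thesis
    by (auto simp: cancel_step_Cons)
qed simp

lemma reduce_fpath_reduce [simp]:
  "reduce (p @ fpath S (reduce s) @ q) = reduce (p @ fpath S s @ q)"
proof (induction s arbitrary: p)
  case (Cons x s)
  have "reduce (p @ fpath S (reduce (x # s)) @ q) = reduce (p @ fpath S (x # reduce s) @ q)"
    by (simp add: reduce_Cons reduce_fpath_cancel_step)
  also have "\<dots> = reduce ((p @ fpath S [x]) @ fpath S (reduce s) @ q)"
    by (metis append_Cons append_Nil append_assoc fpath_append)
  also have "\<dots> = reduce ((p @ fpath S [x]) @ fpath S s @ q)"
    by (rule Cons.IH)
  also have "\<dots> = reduce (p @ fpath S (x # s) @ q)"
    by (metis append_Cons append_Nil append_assoc fpath_append)
  finally show ?case .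
qed simp

lemma reduce_fpath_reduce_simps [simp]:
  "reduce (fpath S (reduce s) @ q) = reduce (fpath S s @ q)"
  "reduce (p @ fpath S (reduce s)) = reduce (p @ fpath S s)"
  "reduce (fpath S (reduce s)) = reduce (fpath S s)"
  using reduce_fpath_reduce[of "[]" S s q] reduce_fpath_reduce[of p S s "[]"]
    reduce_fpath_reduce[of "[]" S s "[]"] by simp_all

lemma ftil_append: "ftil S (reduce (p @ q)) = reduce (ftil S p @ fpath S q)"
  by (simp add: ftil_def fpath_append)

text \<open>Equivariance of the lift: the factor \<open>pinv (glift S)\<close> that closes
  \<open>Phi S g\<close> cancels against the \<open>glift S\<close> that opens
  \<open>ftil S p\<close>.\<close>

lemma ftil_deck: "ftil S (reduce (g @ p)) = reduce (Phi S g @ ftil S p)"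
  using reduce_pinv_cancel_mid(2)[of "glift S @ fpath S g" "glift S" "fpath S p"]
  by (simp add: ftil_def Phi_def fpath_append)

lemma reduced_ftil [simp]: "reduced_path (ftil S p)"
  by (simp add: ftil_def)

text \<open>For \<open>p\<close> and \<open>q\<close> with the same end vertex the argument on the
  left is a loop, so injectivity of \<open>ftil\<close> on a fibre will follow from that of
  \<open>Phi\<close>.\<close>

lemma Phi_quotient: "Phi S (reduce (p @ pinv q)) = reduce (ftil S p @ pinv (ftil S q))"
  by (simp add: Phi_def ftil_def fpath_append fpath_pinv pinv_append)

section \<open>Integral chains of lifted paths\<close>

lemma liftchain_Cons:
  "liftchain q (x # s) a =
     (if snd x then if a = (q, fst x) then 1 else 0
      else if a = (reduce (q @ [x]), fst x) then -1 else 0) + liftchain (reduce (q @ [x])) s a"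
  by (cases x; cases "snd x") (auto simp: Let_def)

declare liftchain.simps(2) [simp del]

lemma liftchain_append:
  assumes "reduced_path q"
  shows "liftchain q (p @ s) a = liftchain q p a + liftchain (reduce (q @ p)) s a"
  using assms
proof (induction p arbitrary: q)
  case (Cons x p)
  then show ?case
    by (simp add: liftchain_Cons)
qed (simp add: reduce_reduced)

text \<open>A backtrack crosses one cover edge twice with opposite signs and returns to
  \<open>q\<close>; hence the chain of a path depends only on its reduced word.\<close>

lemma liftchain_cancel_step:
  assumes "reduced_path q"
  shows "liftchain q (cancel_step x acc) a = liftchain q (x # acc) a"
proof (cases acc)
  case (Cons y r)
  have eq: "reduce (q @ [x, linv x]) = q"
    using reduce_pinv_cancel_mid(3)[of q "[x]"] assms by (simp add: pinv_Cons reduce_reduced)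
  have "liftchain q (x # linv x # r) a = liftchain q r a"
    using eq by (cases "snd x") (simp_all add: liftchain_Cons linv_def)
  with Cons show ?thesis
    by (auto simp: cancel_step_Cons)
qed simp

lemma liftchain_reduce:
  assumes "reduced_path q"
  shows "liftchain q (reduce s) a = liftchain q s a"
  using assms
proof (induction s arbitrary: q)
  case (Cons x s)
  then show ?case
    by (simp add: reduce_Cons liftchain_cancel_step) (simp add: liftchain_Cons)
qed simp

lemma liftchain_pinv:
  assumes "reduced_path q"
  shows "liftchain q (pinv s) a = - liftchain (reduce (q @ pinv s)) s a"
  using liftchain_reduce[OF assms, of "pinv s @ s" a] liftchain_append[OF assms, of "pinv s" s a] by simp

text \<open>Left translation by \<open>g\<close> is injective on reduced words, so it does not
  change which cover edges coincide.\<close>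

lemma liftchain_deck:
  assumes "reduced_path q" "reduced_path p"
  shows "liftchain (reduce (g @ q)) s (reduce (g @ p), e) = liftchain q s (p, e)"
  using assms
proof (induction s arbitrary: q)
  case (Cons x s)
  have "liftchain (reduce (g @ reduce (q @ [x]))) s (reduce (g @ p), e) = liftchain (reduce (q @ [x])) s (p, e)"
    using Cons.IH[of "reduce (q @ [x])"] Cons.prems by simp
  then have "liftchain (reduce (g @ q @ [x])) s (reduce (g @ p), e) = liftchain (reduce (q @ [x])) s (p, e)"
    by simp
  moreover have "reduce (g @ q @ [x]) = reduce (g @ p) \<longleftrightarrow> reduce (q @ [x]) = p"
    using reduce_append_cancel_left[of "reduce (q @ [x])" p g] Cons by simp
  ultimately show ?case
    using Cons.prems by (auto simp: liftchain_Cons reduce_append_cancel_left)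
qed simp

text \<open>The first component of a cover edge is its initial vertex: the path stands there before
  a forward step and after a backward one, so the prefix may be all of \<open>s\<close>.\<close>

lemma liftchain_nonzeroD:
  assumes "reduced_path q" "liftchain q s a \<noteq> 0"
  shows "snd a \<in> fst ` set s \<and> (\<exists>i\<le>length s. fst a = reduce (q @ take i s))"
  using assms
proof (induction s arbitrary: q)
  case (Cons x s)
  show ?case
  proof (cases "liftchain (reduce (q @ [x])) s a = 0")
    case True
    with Cons.prems show ?thesis
      by (fastforce simp: liftchain_Cons reduce_reduced split: if_splits
          intro: exI[of _ 0] exI[of _ 1])
  next
    case False
    with Cons.IH[of "reduce (q @ [x])"] obtain i where
      "snd a \<in> fst ` set s" "i \<le> length s" "fst a = reduce (q @ take (Suc i) (x # s))"
      by auto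
    then show ?thesis
      by (intro conjI exI[of _ "Suc i"]) auto
  qed
qed simp

lemma abs_liftchain_le: "\<bar>liftchain q s a\<bar> \<le> int (length s)"
proof (induction s arbitrary: q)
  case (Cons x s)
  have "\<bar>c + r\<bar> \<le> int (length (x # s))"
    if "\<bar>c\<bar> \<le> 1" "\<bar>r\<bar> \<le> int (length s)" for c r
    using that by simp
  from this[OF _ Cons] show ?case
    unfolding liftchain_Cons by simp
qed simp

lemma liftchain_support:
  "finite {a. liftchain q s a \<noteq> 0} \<and> card {a. liftchain q s a \<noteq> 0} \<le> length s"
proof (induction s arbitrary: q)
  case (Cons x s)
  let ?b = "(if snd x then q else reduce (q @ [x]), fst x)"
  let ?B = "{a. liftchain (reduce (q @ [x])) s a \<noteq> 0}"
  have B: "finite ?B" "card ?B \<le> length s"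
    using Cons[of "reduce (q @ [x])"] by auto
  have sub: "{a. liftchain q (x # s) a \<noteq> 0} \<subseteq> insert ?b ?B"
    by (auto simp: liftchain_Cons)
  have "card {a. liftchain q (x # s) a \<noteq> 0} \<le> card (insert ?b ?B)"
    using B sub by (intro card_mono) auto
  also have "\<dots> \<le> length (x # s)"
    using B by (simp add: card_insert_if)
  finally show ?case
    using finite_subset[OF sub] B by simp
qed simp

section \<open>Square-summable functions\<close>

text \<open>Brings membership and norm bounds down to finite sets, where the inequalities for
  \<open>L2_set\<close> apply.\<close>

lemma l2_nrm_boundI:
  assumes "\<And>a. a \<notin> D \<Longrightarrow> x a = 0"
    and "\<And>F. finite F \<Longrightarrow> L2_set (\<lambda>a. cmod (x a)) F \<le> c"
  shows "x \<in> l2 D" "nrm x \<le> c"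
proof -
  have c: "c \<ge> 0"
    using assms(2)[of "{}"] by simp
  have le: "(\<Sum>a\<in>F. (cmod (x a))\<^sup>2) \<le> c\<^sup>2" if "finite F" for F
  proof -
    have "sqrt (\<Sum>a\<in>F. (cmod (x a))\<^sup>2) \<le> c"
      using assms(2)[OF that] by (simp add: L2_set_def)
    then show ?thesis
      using sqrt_le_D by blast
  qed
  have sum: "(\<lambda>a. (cmod (x a))\<^sup>2) summable_on UNIV"
    by (rule nonneg_bdd_above_summable_on) (auto simp: bdd_above_def intro!: exI[of _ "c\<^sup>2"] le)
  then show "x \<in> l2 D"
    using assms(1) by (simp add: l2_def)
  have "(\<Sum>\<^sub>\<infinity>a. (cmod (x a))\<^sup>2) \<le> c\<^sup>2"
    by (rule infsum_le_finite_sums[OF sum]) (auto intro: le)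
  then show "nrm x \<le> c"
    unfolding nrm_def using c by (simp add: real_le_lsqrt)
qed

lemma l2_zero_off: "x \<in> l2 D \<Longrightarrow> a \<notin> D \<Longrightarrow> x a = 0"
  by (simp add: l2_def)

lemma l2_summable: "x \<in> l2 D \<Longrightarrow> (\<lambda>a. (cmod (x a))\<^sup>2) summable_on UNIV"
  by (simp add: l2_def)

lemma nrm_nonneg [simp]: "0 \<le> nrm x"
  by (simp add: nrm_def infsum_nonneg)

lemma nrm_square: "(nrm x)\<^sup>2 = (\<Sum>\<^sub>\<infinity>a. (cmod (x a))\<^sup>2)"
  by (simp add: nrm_def infsum_nonneg)

lemma L2_set_le_nrm:
  assumes "x \<in> l2 D"
  shows "L2_set (\<lambda>a. cmod (x a)) F \<le> nrm x"
proof (cases "finite F")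
  case True
  have "(\<Sum>a\<in>F. (cmod (x a))\<^sup>2) \<le> (\<Sum>\<^sub>\<infinity>a. (cmod (x a))\<^sup>2)"
    using l2_summable[OF assms] True by (intro finite_sum_le_infsum) auto
  then show ?thesis
    by (simp add: L2_set_def nrm_def)
qed simp

lemma l2_zero [simp]: "(\<lambda>_. 0) \<in> l2 D"
  by (simp add: l2_def)

lemma nrm_zero [simp]: "nrm (\<lambda>_. 0) = 0"
  by (simp add: nrm_def)

lemma l2_dominated:
  assumes "x \<in> l2 D" "\<And>a. cmod (y a) \<le> cmod (x a)" "\<And>a. a \<notin> D' \<Longrightarrow> y a = 0"
  shows "y \<in> l2 D'" "nrm y \<le> nrm x"
proof -
  have "L2_set (\<lambda>a. cmod (y a)) F \<le> nrm x" for F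
    using L2_set_mono[of F "\<lambda>a. cmod (y a)" "\<lambda>a. cmod (x a)"] L2_set_le_nrm[OF assms(1), of F]
      assms(2) by force
  then show "y \<in> l2 D'" "nrm y \<le> nrm x"
    using assms(3) by (auto intro: l2_nrm_boundI)
qed

lemma
  assumes "x \<in> l2 D" "y \<in> l2 D"
  shows l2_add: "(\<lambda>a. x a + y a) \<in> l2 D"
    and nrm_add_le: "nrm (\<lambda>a. x a + y a) \<le> nrm x + nrm y"
proof -
  have "L2_set (\<lambda>a. cmod (x a + y a)) F \<le> nrm x + nrm y" for F
  proof -
    have "L2_set (\<lambda>a. cmod (x a + y a)) F \<le> L2_set (\<lambda>a. cmod (x a) + cmod (y a)) F"
      by (intro L2_set_mono norm_triangle_ineq) auto
    also have "\<dots> \<le> L2_set (\<lambda>a. cmod (x a)) F + L2_set (\<lambda>a. cmod (y a)) F"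
      by (rule L2_set_triangle_ineq)
    finally show ?thesis
      using L2_set_le_nrm[OF assms(1), of F] L2_set_le_nrm[OF assms(2), of F] by linarith
  qed
  then show "(\<lambda>a. x a + y a) \<in> l2 D" "nrm (\<lambda>a. x a + y a) \<le> nrm x + nrm y"
    using assms by (auto intro!: l2_nrm_boundI simp: l2_zero_off)
qed

lemma l2_scale: "x \<in> l2 D \<Longrightarrow> (\<lambda>a. c * x a) \<in> l2 D"
  by (auto simp: l2_def norm_mult power_mult_distrib intro: summable_on_cmult_right)

lemma nrm_scale: "nrm (\<lambda>a. c * x a) = cmod c * nrm x"
proof -
  have "(nrm (\<lambda>a. c * x a))\<^sup>2 = (cmod c * nrm x)\<^sup>2"
    by (simp add: nrm_square power_mult_distrib norm_mult infsum_cmult_right')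
  then show ?thesis
    by (rule power2_eq_imp_eq) auto
qed

lemma nrm_diff_commute: "nrm (\<lambda>a. x a - y a) = nrm (\<lambda>a. y a - x a)"
  by (simp add: nrm_def norm_minus_commute)

lemma l2_diff: "x \<in> l2 D \<Longrightarrow> y \<in> l2 D \<Longrightarrow> (\<lambda>a. x a - y a) \<in> l2 D"
  using l2_add[of x D "\<lambda>a. -1 * y a"] l2_scale[of y D "-1"] by simp

lemma nrm_diff_triangle:
  assumes "x \<in> l2 D" "y \<in> l2 D" "z \<in> l2 D"
  shows "nrm (\<lambda>a. x a - z a) \<le> nrm (\<lambda>a. x a - y a) + nrm (\<lambda>a. y a - z a)"
  using nrm_add_le[OF l2_diff[OF assms(1,2)] l2_diff[OF assms(2,3)]] by simp

lemma nrm_le_diff: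
  assumes "x \<in> l2 D" "y \<in> l2 D"
  shows "nrm x \<le> nrm (\<lambda>a. x a - y a) + nrm y"
  using nrm_add_le[OF l2_diff[OF assms] assms(2)] by simp

lemma nrm_diff_add_le:
  assumes "x \<in> l2 D" "y \<in> l2 D" "u \<in> l2 D" "v \<in> l2 D"
  shows "nrm (\<lambda>a. (x a + y a) - (u a + v a)) \<le> nrm (\<lambda>a. x a - u a) + nrm (\<lambda>a. y a - v a)"
  using nrm_add_le[OF l2_diff[OF assms(1,3)] l2_diff[OF assms(2,4)]] by (simp add: algebra_simps)

lemma tendsto_nrm:
  assumes "\<And>j. s j \<in> l2 D" "x \<in> l2 D" "(\<lambda>j. nrm (\<lambda>a. s j a - x a)) \<longlonglongrightarrow> 0"
  shows "(\<lambda>j. nrm (s j)) \<longlonglongrightarrow> nrm x"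
proof -
  have "norm (nrm (s j) - nrm x) \<le> nrm (\<lambda>a. s j a - x a)" for j
    using nrm_le_diff[OF assms(1)[of j] assms(2)] nrm_le_diff[OF assms(2) assms(1)[of j]]
    by (simp add: nrm_diff_commute[of x] abs_le_iff)
  then have "(\<lambda>j. nrm (s j) - nrm x) \<longlonglongrightarrow> 0"
    by (intro Lim_null_comparison[OF _ assms(3)]) auto
  then show ?thesis
    by (simp add: LIM_zero_iff)
qed

lemma l2_finite_support:
  assumes "finite {a. x a \<noteq> 0}" "\<And>a. a \<notin> D \<Longrightarrow> x a = 0"
  shows "x \<in> l2 D"
proof -
  have "(\<lambda>a. (cmod (x a))\<^sup>2) summable_on UNIV \<longleftrightarrow> (\<lambda>a. (cmod (x a))\<^sup>2) summable_on {a. x a \<noteq> 0}"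
    by (rule summable_on_cong_neutral) auto
  then show ?thesis
    using assms by (auto simp: l2_def)
qed

section \<open>Slices and copies at a single level\<close>

lemma
  assumes "x \<in> l2 D" "inj h"
  shows l2_reindex: "(\<lambda>a. x (h a)) \<in> l2 (h -` D)"
    and nrm_reindex_le: "nrm (\<lambda>a. x (h a)) \<le> nrm x"
proof -
  have "L2_set (\<lambda>a. cmod (x (h a))) F = L2_set (\<lambda>a. cmod (x a)) (h ` F)" for F
    using assms(2) by (simp add: L2_set_def sum.reindex inj_on_subset)
  then have "L2_set (\<lambda>a. cmod (x (h a))) F \<le> nrm x" for F
    using L2_set_le_nrm[OF assms(1)] by simp
  then show "(\<lambda>a. x (h a)) \<in> l2 (h -` D)" "nrm (\<lambda>a. x (h a)) \<le> nrm x"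
    using l2_zero_off[OF assms(1)] by (auto intro!: l2_nrm_boundI)
qed

lemma
  assumes "x \<in> l2 (UNIV \<times> D)"
  shows l2_slice: "(\<lambda>a. x (l, a)) \<in> l2 D"
    and nrm_slice_le: "nrm (\<lambda>a. x (l, a)) \<le> nrm x"
proof -
  have "inj (Pair l)"
    by (simp add: inj_on_def)
  moreover have "Pair l -` (UNIV \<times> D) = D"
    by auto
  ultimately show "(\<lambda>a. x (l, a)) \<in> l2 D" "nrm (\<lambda>a. x (l, a)) \<le> nrm x"
    using l2_reindex[OF assms] nrm_reindex_le[OF assms] by metis+
qed

text \<open>For integer levels this is the element \<open>t^l x\<close> in the sequence model of the
  square-summable functions on the mapping torus group.\<close>

definition inject :: "'k \<Rightarrow> ('a \<Rightarrow> complex) \<Rightarrow> 'k \<times> 'a \<Rightarrow> complex" where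
  "inject l x = (\<lambda>(k, a). if k = l then x a else 0)"

lemma
  assumes "x \<in> l2 D"
  shows l2_inject: "inject l x \<in> l2 (UNIV \<times> D)"
    and nrm_inject_le: "nrm (inject l x) \<le> nrm x"
proof -
  have le: "L2_set (\<lambda>p. cmod (inject l x p)) F \<le> nrm x" if "finite F" for F
  proof -
    let ?G = "{p \<in> F. fst p = l}"
    have "(\<Sum>p\<in>F. (cmod (inject l x p))\<^sup>2) = (\<Sum>p\<in>?G. (cmod (x (snd p)))\<^sup>2)"
      using that by (intro sum.mono_neutral_cong_right) (auto simp: inject_def split: if_splits)
    also have "\<dots> = (\<Sum>a\<in>snd ` ?G. (cmod (x a))\<^sup>2)"
      by (subst sum.reindex) (auto simp: inj_on_def)
    finally have "L2_set (\<lambda>p. cmod (inject l x p)) F = L2_set (\<lambda>a. cmod (x a)) (snd ` ?G)"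
      by (simp add: L2_set_def)
    then show ?thesis
      using L2_set_le_nrm[OF assms] by simp
  qed
  have off: "inject l x p = 0" if "p \<notin> UNIV \<times> D" for p
    using that l2_zero_off[OF assms] by (cases p) (simp add: inject_def)
  show "inject l x \<in> l2 (UNIV \<times> D)" "nrm (inject l x) \<le> nrm x"
    using l2_nrm_boundI[OF off le] by auto
qed

section \<open>Tails and sparse matrices\<close>

lemma l2_tail:
  assumes "x \<in> l2 D" "\<epsilon> > 0"
  obtains F where "finite F" "F \<subseteq> D" "nrm (\<lambda>a. if a \<in> F then 0 else x a) < \<epsilon>"
proof -
  let ?f = "\<lambda>a. (cmod (x a))\<^sup>2"
  have sum: "?f summable_on UNIV"
    by (rule l2_summable) fact
  obtain G where G: "finite G" "dist (sum ?f G) (infsum ?f UNIV) < \<epsilon>\<^sup>2"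
    using infsum_finite_approximation[OF sum, of "\<epsilon>\<^sup>2 / 2"] assms(2)
    by (smt (verit) field_sum_of_halves zero_less_power)
  define F where "F = G \<inter> D"
  have "sum ?f F = sum ?f G"
    unfolding F_def using G assms by (intro sum.mono_neutral_left) (auto simp: l2_zero_off)
  have F: "finite F" "F \<subseteq> D"
    using G by (auto simp: F_def)
  have "infsum ?f UNIV = infsum ?f F + infsum ?f (- F)"
    using infsum_Un_disjoint[of ?f F "- F"] summable_on_subset_banach[OF sum] by simp
  moreover have "(nrm (\<lambda>a. if a \<in> F then 0 else x a))\<^sup>2 = infsum ?f (- F)"
    unfolding nrm_square by (rule infsum_cong_neutral) auto
  ultimately have "(nrm (\<lambda>a. if a \<in> F then 0 else x a))\<^sup>2 < \<epsilon>\<^sup>2"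
    using G F \<open>sum ?f F = sum ?f G\<close> by (simp add: dist_real_def)
  then have "nrm (\<lambda>a. if a \<in> F then 0 else x a) < \<epsilon>"
    using assms(2) power2_less_imp_less by fastforce
  with F that show thesis by blast
qed

text \<open>A Schur test: \<open>R b\<close> contains the support of row \<open>b\<close>, rows and
  columns are uniformly short and the entries bounded. Cauchy-Schwarz is applied in each row, and
  exchanging the sums counts each coordinate of \<open>x\<close> at most \<open>K\<close>
  times.\<close>

lemma
  fixes m :: "'b \<Rightarrow> 'a \<Rightarrow> complex" and K :: nat
  assumes R: "\<And>b. finite (R b)" "\<And>b. card (R b) \<le> K"
    and R': "\<And>a. finite {b. a \<in> R b}" "\<And>a. card {b. a \<in> R b} \<le> K"
    and m: "\<And>b a. cmod (m b a) \<le> K"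
    and x: "x \<in> l2 D"
    and off: "\<And>b. b \<notin> D' \<Longrightarrow> R b = {}"
  shows sparse_l2: "(\<lambda>b. \<Sum>a\<in>R b. m b a * x a) \<in> l2 D'"
    and nrm_sparse_le: "nrm (\<lambda>b. \<Sum>a\<in>R b. m b a * x a) \<le> (real K)\<^sup>2 * nrm x"
proof -
  have "L2_set (\<lambda>b. cmod (\<Sum>a\<in>R b. m b a * x a)) F \<le> (real K)\<^sup>2 * nrm x" if F: "finite F" for F
  proof -
    let ?G = "\<Union>b\<in>F. R b"
    have G: "finite ?G"
      using F R by auto
    \<comment> \<open>The cube consists of \<open>K\<^sup>2\<close> from the entries and
      \<open>K\<close> from Cauchy-Schwarz over at most \<open>K\<close> terms. The column count
      contributes a fourth factor, and the square root of \<open>K ^ 4\<close> is the constant of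
      the lemma.\<close>
    have row: "(cmod (\<Sum>a\<in>R b. m b a * x a))\<^sup>2 \<le> real K ^ 3 * (\<Sum>a\<in>R b. (cmod (x a))\<^sup>2)" for b
    proof -
      have "cmod (\<Sum>a\<in>R b. m b a * x a) \<le> (\<Sum>a\<in>R b. real K * cmod (x a))"
        by (rule order_trans[OF norm_sum sum_mono]) (simp add: norm_mult m mult_right_mono)
      then have "(cmod (\<Sum>a\<in>R b. m b a * x a))\<^sup>2 \<le> (\<Sum>a\<in>R b. real K * cmod (x a))\<^sup>2"
        by (intro power_mono) auto
      also have "\<dots> = (real K)\<^sup>2 * (\<Sum>a\<in>R b. cmod (x a))\<^sup>2"
        by (simp add: sum_distrib_left[symmetric] power_mult_distrib)
      also have "\<dots> \<le> (real K)\<^sup>2 * (real (card (R b)) * (\<Sum>a\<in>R b. (cmod (x a))\<^sup>2))"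
        using sum_squared_le_sum_of_squares[of "\<lambda>a. cmod (x a)" "R b"]
        by (intro mult_left_mono) (auto simp: mult.commute)
      also have "\<dots> \<le> (real K)\<^sup>2 * (real K * (\<Sum>a\<in>R b. (cmod (x a))\<^sup>2))"
        using R by (intro mult_left_mono mult_right_mono) (auto intro: sum_nonneg)
      finally show ?thesis
        by (simp add: power2_eq_square power3_eq_cube mult_ac)
    qed
    have "(\<Sum>b\<in>F. \<Sum>a\<in>R b. (cmod (x a))\<^sup>2) = (\<Sum>b\<in>F. \<Sum>a | a \<in> ?G \<and> a \<in> R b. (cmod (x a))\<^sup>2)"
      by (intro sum.cong refl) auto
    also have "\<dots> = (\<Sum>a\<in>?G. \<Sum>b | b \<in> F \<and> a \<in> R b. (cmod (x a))\<^sup>2)"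
      by (rule sum.swap_restrict[OF F G])
    also have "\<dots> \<le> (\<Sum>a\<in>?G. real K * (cmod (x a))\<^sup>2)"
    proof (rule sum_mono)
      fix a
      have "card {b \<in> F. a \<in> R b} \<le> K"
        using card_mono[OF R'(1)[of a], of "{b \<in> F. a \<in> R b}"] R'(2)[of a] by force
      then show "(\<Sum>b | b \<in> F \<and> a \<in> R b. (cmod (x a))\<^sup>2) \<le> real K * (cmod (x a))\<^sup>2"
        by (simp add: mult_right_mono)
    qed
    finally have swap: "(\<Sum>b\<in>F. \<Sum>a\<in>R b. (cmod (x a))\<^sup>2) \<le> real K * (\<Sum>a\<in>?G. (cmod (x a))\<^sup>2)"
      by (simp add: sum_distrib_left)
    have "(\<Sum>b\<in>F. (cmod (\<Sum>a\<in>R b. m b a * x a))\<^sup>2) \<le> (\<Sum>b\<in>F. real K ^ 3 * (\<Sum>a\<in>R b. (cmod (x a))\<^sup>2))"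
      by (intro sum_mono row)
    also have "\<dots> \<le> real K ^ 3 * (real K * (\<Sum>a\<in>?G. (cmod (x a))\<^sup>2))"
      using swap by (simp add: sum_distrib_left[symmetric] mult_left_mono)
    also have "\<dots> = ((real K)\<^sup>2 * L2_set (\<lambda>a. cmod (x a)) ?G)\<^sup>2"
      by (simp add: L2_set_def power_mult_distrib sum_nonneg power2_eq_square power3_eq_cube mult_ac)
    finally have "L2_set (\<lambda>b. cmod (\<Sum>a\<in>R b. m b a * x a)) F \<le> (real K)\<^sup>2 * L2_set (\<lambda>a. cmod (x a)) ?G"
      unfolding L2_set_def[of _ F] by (intro real_le_lsqrt) (auto intro: sum_nonneg)
    also have "\<dots> \<le> (real K)\<^sup>2 * nrm x"
      using L2_set_le_nrm[OF x] by (intro mult_left_mono) auto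
    finally show ?thesis .
  qed
  moreover have "(\<Sum>a\<in>R b. m b a * x a) = 0" if "b \<notin> D'" for b
    using off[OF that] by simp
  ultimately show "(\<lambda>b. \<Sum>a\<in>R b. m b a * x a) \<in> l2 D'"
    "nrm (\<lambda>b. \<Sum>a\<in>R b. m b a * x a) \<le> (real K)\<^sup>2 * nrm x"
    by (auto intro: l2_nrm_boundI)
qed

section \<open>Polarisation and angles\<close>

lemma Re_cinner:
  assumes "x \<in> l2 D" "y \<in> l2 D"
  shows "2 * Re (cinner x y) = (nrm x)\<^sup>2 + (nrm y)\<^sup>2 - (nrm (\<lambda>a. x a - y a))\<^sup>2"
proof -
  note s = l2_summable[OF assms(1)] l2_summable[OF assms(2)] l2_summable[OF l2_diff[OF assms]]
  have "cmod (x a * cnj (y a)) \<le> (cmod (x a))\<^sup>2 + (cmod (y a))\<^sup>2" for a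
    using sum_squares_bound[of "cmod (x a)" "cmod (y a)"]
      mult_nonneg_nonneg[OF norm_ge_zero norm_ge_zero, of "x a" "y a"]
    unfolding norm_mult complex_mod_cnj by linarith
  then have "(\<lambda>a. x a * cnj (y a)) summable_on UNIV"
    by (rule abs_summable_summable[OF Infinite_Sum.abs_summable_on_comparison_test'[OF summable_on_add[OF s(1,2)]]])
  then have "((\<lambda>a. x a * cnj (y a)) has_sum cinner x y) UNIV"
    by (simp add: cinner_def)
  then have "((\<lambda>a. Re (x a * cnj (y a))) has_sum Re (cinner x y)) UNIV"
    by (rule has_sum_Re)
  then have 1: "((\<lambda>a. 2 * Re (x a * cnj (y a))) has_sum 2 * Re (cinner x y)) UNIV"
    by (rule has_sum_cmult_right)
  have "((\<lambda>a. (cmod (x a))\<^sup>2 + (cmod (y a))\<^sup>2) has_sum (nrm x)\<^sup>2 + (nrm y)\<^sup>2) UNIV"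
    unfolding nrm_square by (intro has_sum_add has_sum_infsum s)
  moreover have "((\<lambda>a. 2 * Re (x a * cnj (y a)) + (cmod (x a - y a))\<^sup>2)
      has_sum 2 * Re (cinner x y) + (nrm (\<lambda>a. x a - y a))\<^sup>2) UNIV"
    unfolding nrm_square by (intro has_sum_add[OF 1] has_sum_infsum s)
  moreover have "2 * Re (x a * cnj (y a)) + (cmod (x a - y a))\<^sup>2 = (cmod (x a))\<^sup>2 + (cmod (y a))\<^sup>2" for a
    by (simp add: cmod_power2) (simp add: power2_eq_square algebra_simps)
  ultimately have "2 * Re (cinner x y) + (nrm (\<lambda>a. x a - y a))\<^sup>2 = (nrm x)\<^sup>2 + (nrm y)\<^sup>2"
    using has_sum_unique by fastforce
  then show ?thesis
    by simp
qed

text \<open>By polarisation it suffices to combine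
  \<open>2 * n * nrm z \<le> n\<^sup>2 + (nrm z)\<^sup>2\<close> with
  \<open>d\<^sup>2 < 2 * t * n * nrm z\<close>. The latter holds because \<open>d\<close> is less
  than \<open>n / 2\<close>, so that \<open>n \<le> 2 * nrm z\<close>, while
  \<open>d\<^sup>2\<close> is at most \<open>t\<^sup>2 * n\<^sup>2 / 4\<close>.\<close>

lemma cinner_gt_of_close:
  assumes "v \<in> l2 D" "z \<in> l2 D" "0 < \<theta>" "\<theta> < 1"
    and close: "nrm (\<lambda>a. z a - v a) < (1 - \<theta>) / 2 * nrm v"
  shows "Re (cinner v z) > \<theta> * nrm v * nrm z"
proof -
  define t n d where "t = 1 - \<theta>" and "n = nrm v" and "d = nrm (\<lambda>a. v a - z a)"
  have t: "0 < t" "t < 1"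
    using assms by (auto simp: t_def)
  have d: "0 \<le> d" "d < t / 2 * n"
    using close by (auto simp: d_def n_def t_def nrm_diff_commute[of v z])
  then have n: "0 < n"
    using t by (metis n_def nrm_nonneg order_le_less_trans mult_zero_right order_le_less)
  have z: "n - d \<le> nrm z"
    using nrm_le_diff[OF assms(1,2)] by (simp add: n_def d_def)
  have "d\<^sup>2 \<le> (t / 2 * n)\<^sup>2"
    using d by (intro power_mono) auto
  also have "\<dots> = t\<^sup>2 * (n * n) / 4"
    by (simp add: power2_eq_square field_simps)
  also have "\<dots> < t * (n * n)"
    using t n by (simp add: power2_eq_square field_simps)
  also have "t * (n * n) \<le> t * (n * (2 * (n - d)))"
  proof -
    have "t / 2 * n \<le> 1 / 2 * n"
      using t n by (intro mult_right_mono) auto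
    then have "n \<le> 2 * (n - d)"
      using d by simp
    then show ?thesis
      using t n by (intro mult_left_mono) auto
  qed
  also have "\<dots> \<le> t * (n * (2 * nrm z))"
    using z t n by (intro mult_left_mono) auto
  finally have "d\<^sup>2 < 2 * t * n * nrm z"
    by simp
  moreover have "2 * n * nrm z \<le> n\<^sup>2 + (nrm z)\<^sup>2"
    by (rule sum_squares_bound)
  ultimately have "2 * (\<theta> * n * nrm z) < n\<^sup>2 + (nrm z)\<^sup>2 - d\<^sup>2"
    by (simp add: t_def algebra_simps)
  also have "\<dots> = 2 * Re (cinner v z)"
    unfolding n_def d_def by (rule Re_cinner[OF assms(1,2), symmetric])
  finally show ?thesis
    by (simp add: n_def)
qed

section \<open>Closures and complex spans\<close>

lemma lclosure_iff:
  "y \<in> lclosure D X \<longleftrightarrow> y \<in> l2 D \<and> (\<forall>\<epsilon>>0. \<exists>s\<in>X. nrm (\<lambda>a. s a - y a) < \<epsilon>)"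
proof (intro iffI conjI allI impI; (elim conjE)?)
  fix \<epsilon> :: real assume y: "y \<in> lclosure D X" and "\<epsilon> > 0"
  then obtain s where s: "\<And>n. s n \<in> X" "(\<lambda>n. nrm (\<lambda>a. s n a - y a)) \<longlonglongrightarrow> 0"
    by (auto simp: lclosure_def)
  obtain n where "nrm (\<lambda>a. s n a - y a) < \<epsilon>"
    using order_tendstoD(2)[OF s(2) \<open>\<epsilon> > 0\<close>] by (auto simp: eventually_sequentially)
  with s show "\<exists>s\<in>X. nrm (\<lambda>a. s a - y a) < \<epsilon>" by blast
next
  assume y: "y \<in> l2 D" and *: "\<forall>\<epsilon>>0. \<exists>s\<in>X. nrm (\<lambda>a. s a - y a) < \<epsilon>"
  have "\<forall>n. \<exists>s\<in>X. nrm (\<lambda>a. s a - y a) < inverse (real (Suc n))"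
    using * by auto
  then obtain s where s: "\<And>n. s n \<in> X" "\<And>n. nrm (\<lambda>a. s n a - y a) < inverse (real (Suc n))"
    by metis
  have "(\<lambda>n. nrm (\<lambda>a. s n a - y a)) \<longlonglongrightarrow> 0"
    by (rule tendsto_sandwich[OF _ _ tendsto_const LIMSEQ_inverse_real_of_nat]) (auto intro!: always_eventually less_imp_le[OF s(2)] simp del: of_nat_Suc)
  with y s show "y \<in> lclosure D X"
    by (auto simp: lclosure_def)
qed (auto simp: lclosure_def)

lemma lclosure_l2: "y \<in> lclosure D X \<Longrightarrow> y \<in> l2 D"
  by (simp add: lclosure_iff)

lemma lclosure_superset: "X \<subseteq> l2 D \<Longrightarrow> X \<subseteq> lclosure D X"
proof
  fix x assume "X \<subseteq> l2 D" "x \<in> X"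
  then show "x \<in> lclosure D X"
    by (auto simp: lclosure_iff intro!: bexI[of _ x])
qed

lemma lclosure_closed:
  assumes "X \<subseteq> lclosure D Y" "Y \<subseteq> l2 D"
  shows "lclosure D X \<subseteq> lclosure D Y"
proof
  fix x assume x: "x \<in> lclosure D X"
  show "x \<in> lclosure D Y"
    unfolding lclosure_iff
  proof (intro conjI allI impI)
    show l2: "x \<in> l2 D"
      using x by (rule lclosure_l2)
    fix \<epsilon> :: real assume "\<epsilon> > 0"
    then obtain z where z: "z \<in> X" "nrm (\<lambda>a. z a - x a) < \<epsilon> / 2"
      using x unfolding lclosure_iff by (metis half_gt_zero)
    then have "z \<in> lclosure D Y"
      using assms by auto
    with \<open>\<epsilon> > 0\<close> obtain w where w: "w \<in> Y" "nrm (\<lambda>a. w a - z a) < \<epsilon> / 2"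
      unfolding lclosure_iff by (metis half_gt_zero)
    have "nrm (\<lambda>a. w a - x a) < \<epsilon>"
      using nrm_diff_triangle[of w D z x] w z l2 \<open>z \<in> lclosure D Y\<close> lclosure_l2 assms(2) by fastforce
    with w show "\<exists>s\<in>Y. nrm (\<lambda>a. s a - x a) < \<epsilon>" by blast
  qed
qed

lemma lclosure_add:
  assumes "X \<subseteq> l2 D" "\<And>x y. x \<in> X \<Longrightarrow> y \<in> X \<Longrightarrow> (\<lambda>a. x a + y a) \<in> X"
    and "x \<in> lclosure D X" "y \<in> lclosure D X"
  shows "(\<lambda>a. x a + y a) \<in> lclosure D X"
  unfolding lclosure_iff
proof (intro conjI allI impI)
  have l2: "x \<in> l2 D" "y \<in> l2 D"
    using assms(3,4) by (auto dest: lclosure_l2)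
  then show "(\<lambda>a. x a + y a) \<in> l2 D"
    by (rule l2_add)
  fix \<epsilon> :: real assume "\<epsilon> > 0"
  then obtain s t where st: "s \<in> X" "nrm (\<lambda>a. s a - x a) < \<epsilon> / 2" "t \<in> X" "nrm (\<lambda>a. t a - y a) < \<epsilon> / 2"
    using assms(3,4) unfolding lclosure_iff by (metis half_gt_zero)
  then have "nrm (\<lambda>a. (s a + t a) - (x a + y a)) < \<epsilon>"
    using nrm_diff_add_le[OF subsetD[OF assms(1) st(1)] subsetD[OF assms(1) st(3)] l2]
    by linarith
  then show "\<exists>u\<in>X. nrm (\<lambda>a. u a - (x a + y a)) < \<epsilon>"
    by (rule bexI[where x = "\<lambda>a. s a + t a"]) (rule assms(2)[OF st(1,3)])
qed

lemma lclosure_scale: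
  assumes "\<And>x. x \<in> X \<Longrightarrow> (\<lambda>a. c * x a) \<in> X" "x \<in> lclosure D X"
  shows "(\<lambda>a. c * x a) \<in> lclosure D X"
  unfolding lclosure_iff
proof (intro conjI allI impI)
  show "(\<lambda>a. c * x a) \<in> l2 D"
    using assms(2) by (intro l2_scale lclosure_l2)
  fix \<epsilon> :: real assume "\<epsilon> > 0"
  then have "\<epsilon> / (cmod c + 1) > 0"
    by (simp add: add_nonneg_pos)
  then obtain s where s: "s \<in> X" "nrm (\<lambda>a. s a - x a) < \<epsilon> / (cmod c + 1)"
    using assms(2) unfolding lclosure_iff by metis
  have "nrm (\<lambda>a. c * s a - c * x a) = cmod c * nrm (\<lambda>a. s a - x a)"
    by (simp add: nrm_scale flip: right_diff_distrib)
  also have "\<dots> \<le> (cmod c + 1) * nrm (\<lambda>a. s a - x a)"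
    by (intro mult_right_mono) auto
  also have "\<dots> < \<epsilon>"
    using s(2) by (simp add: pos_less_divide_eq add_nonneg_pos mult.commute)
  finally show "\<exists>u\<in>X. nrm (\<lambda>a. u a - c * x a) < \<epsilon>"
    by (rule bexI[where x = "\<lambda>a. c * s a"]) (rule assms(1)[OF s(1)])
qed

lemma cxspan_add:
  assumes "x \<in> cxspan X" "y \<in> cxspan X"
  shows "(\<lambda>a. x a + y a) \<in> cxspan X"
proof -
  obtain n :: nat and c v where x: "x = (\<lambda>a. \<Sum>i<n. c i * v i a)" "\<forall>i<n. v i \<in> X"
    using assms(1) by (auto simp: cxspan_def)
  obtain m :: nat and d w where y: "y = (\<lambda>a. \<Sum>i<m. d i * w i a)" "\<forall>i<m. w i \<in> X"
    using assms(2) by (auto simp: cxspan_def)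
  let ?c = "\<lambda>i. if i < n then c i else d (i - n)" and ?v = "\<lambda>i. if i < n then v i else w (i - n)"
  have split: "(\<Sum>i<n + k. f i) = (\<Sum>i<n. f i) + (\<Sum>i<k. f (n + i))" for k and f :: "nat \<Rightarrow> complex"
    by (induction k) (simp_all add: add.assoc)
  have "(\<Sum>i<n + m. ?c i * ?v i a) = x a + y a" for a
    by (simp add: split x y)
  moreover have "\<forall>i<n + m. ?v i \<in> X"
    using x y by auto
  ultimately show ?thesis
    unfolding cxspan_def by (intro CollectI exI[of _ "n + m"] exI[of _ ?c] exI[of _ ?v]) simp
qed

lemma cxspan_scale:
  assumes "x \<in> cxspan X"
  shows "(\<lambda>a. c * x a) \<in> cxspan X"
proof -
  obtain n :: nat and d v where x: "x = (\<lambda>a. \<Sum>i<n. d i * v i a)" "\<forall>i<n. v i \<in> X"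
    using assms by (auto simp: cxspan_def)
  then have "(\<lambda>a. c * x a) = (\<lambda>a. \<Sum>i<n. (c * d i) * v i a)"
    by (simp add: sum_distrib_left mult.assoc)
  with x(2) show ?thesis
    unfolding cxspan_def by (intro CollectI exI[of _ n] exI[of _ "\<lambda>i. c * d i"] exI[of _ v]) auto
qed

lemma cxspan_base:
  assumes "x \<in> X" shows "x \<in> cxspan X"
  unfolding cxspan_def using assms
  by (intro CollectI exI[of _ 1] exI[of _ "\<lambda>_. 1"] exI[of _ "\<lambda>_. x"]) simp

lemma cxspan_induct [consumes 1, case_names zero add]:
  assumes "x \<in> cxspan X" "P (\<lambda>_. 0)"
    and "\<And>c x y. x \<in> X \<Longrightarrow> P y \<Longrightarrow> P (\<lambda>a. y a + c * x a)"
  shows "P x"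
proof -
  have "P (\<lambda>a. \<Sum>i<n. c i * v i a)" if "\<forall>i<n. v i \<in> X" for n :: nat and c v
    using that by (induction n) (auto intro: assms)
  with assms(1) show ?thesis
    by (auto simp: cxspan_def)
qed

lemma cxspan_l2:
  assumes "X \<subseteq> l2 D" shows "cxspan X \<subseteq> l2 D"
proof
  fix x assume "x \<in> cxspan X"
  then show "x \<in> l2 D"
    using assms by (induction rule: cxspan_induct) (auto intro!: l2_add l2_scale)
qed

section \<open>Slow growth against flaring\<close>

text \<open>Rational chains approximate only real vectors, so vectors are split into real and
  imaginary parts. The real part stays complex-valued in order that the operators still apply to
  it.\<close>

definition repart :: "('a \<Rightarrow> complex) \<Rightarrow> 'a \<Rightarrow> complex" where
  "repart x = (\<lambda>a. complex_of_real (Re (x a)))"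

lemma l2_repart:
  assumes "x \<in> l2 D"
  shows "repart x \<in> l2 D"
  using assms by (rule l2_dominated) (auto simp: repart_def abs_Re_le_cmod l2_zero_off[OF assms])

lemma nrm_repart_le: "x \<in> l2 D \<Longrightarrow> nrm (repart x) \<le> nrm x"
  by (erule l2_dominated[where D' = UNIV]) (auto simp: repart_def abs_Re_le_cmod)

lemma nrm_repart_diff_le:
  assumes "x \<in> l2 D" "y \<in> l2 D"
  shows "nrm (\<lambda>a. repart x a - repart y a) \<le> nrm (\<lambda>a. x a - y a)"
  using nrm_repart_le[OF l2_diff[OF assms]] by (simp add: repart_def)

lemma tendsto_nrm_add:
  assumes "\<And>j::nat. s j \<in> l2 D" "\<And>j. t j \<in> l2 D" "x \<in> l2 D" "y \<in> l2 D"
    and "(\<lambda>j. nrm (\<lambda>a. s j a - x a)) \<longlonglongrightarrow> 0" "(\<lambda>j. nrm (\<lambda>a. t j a - y a)) \<longlonglongrightarrow> 0"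
  shows "(\<lambda>j. nrm (\<lambda>a. (s j a + t j a) - (x a + y a))) \<longlonglongrightarrow> 0"
proof (rule Lim_null_comparison)
  show "(\<lambda>j. nrm (\<lambda>a. s j a - x a) + nrm (\<lambda>a. t j a - y a)) \<longlonglongrightarrow> 0"
    using tendsto_add[OF assms(5,6)] by simp
  show "\<forall>\<^sub>F j in sequentially. norm (nrm (\<lambda>a. (s j a + t j a) - (x a + y a)))
      \<le> nrm (\<lambda>a. s j a - x a) + nrm (\<lambda>a. t j a - y a)"
    using nrm_diff_add_le[OF assms(1,2,3,4)] by simp
qed

lemma eventually_add_power_le:
  fixes \<mu> :: real
  assumes "\<forall>\<^sub>F j in sequentially. u j \<le> C * \<mu> ^ j" "\<forall>\<^sub>F j in sequentially. v j \<le> C' * \<mu> ^ j"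
    and "\<And>j. w j \<le> u j + v j"
  shows "\<forall>\<^sub>F j in sequentially. w j \<le> (C + C') * \<mu> ^ j"
  using assms(1,2)
proof eventually_elim
  case (elim j)
  then show ?case
    using assms(3)[of j] by (simp add: distrib_right)
qed

section \<open>Exponential rates of real sequences\<close>

lemma eventually_le_power_of_limsup_root:
  fixes u :: "nat \<Rightarrow> real"
  assumes "limsup (\<lambda>j. ereal (root j (u j))) \<le> ereal \<nu>" "\<nu> < \<mu>" "\<And>j. 0 \<le> u j"
  shows "\<forall>\<^sub>F j in sequentially. u j \<le> \<mu> ^ j"
proof -
  have "limsup (\<lambda>j. ereal (root j (u j))) < ereal \<mu>"
    using assms(1,2) by (metis ereal_less_eq(3) le_less_trans less_ereal.simps(1))
  \<comment> \<open>\<open>root 0\<close> is constantly 0 and carries no information, so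
    \<open>j = 0\<close> is excluded.\<close>
  from Limsup_lessD[OF this] eventually_gt_at_top[of 0] show ?thesis
  proof eventually_elim
    case (elim j)
    then have "root j (u j) ^ j \<le> \<mu> ^ j"
      using assms(3) by (intro power_mono) (auto simp: real_root_ge_zero)
    with elim assms(3) show ?case
      by (simp add: real_root_pow_pos2)
  qed
qed

text \<open>The \<open>j\<close>-th root of \<open>j\<close> tends to 1, so linear growth is
  compatible with every rate \<nu> from 1 on. This leaves room for approximating vectors whose orbit
  bounds increase with \<open>j\<close>.\<close>

lemma limsup_root_le_of_le_id:
  assumes "\<And>j. u j \<le> real j" "1 \<le> \<nu>"
  shows "limsup (\<lambda>j. ereal (root j (u j))) \<le> ereal \<nu>"
proof -
  have "root j (u j) \<le> root j (real j)" for j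
    using assms(1)[of j] by (cases "j = 0") auto
  then have "limsup (\<lambda>j. ereal (root j (u j))) \<le> limsup (\<lambda>j. ereal (root j (real j)))"
    by (intro Limsup_mono) auto
  also have "\<dots> = 1"
    using LIMSEQ_root by (intro lim_imp_Limsup) (auto simp: one_ereal_def)
  also have "\<dots> \<le> ereal \<nu>"
    using assms by (simp add: one_ereal_def)
  finally show ?thesis .
qed

text \<open>The flare inequality makes a sequence grow exponentially from the first moment at which it
fails to decay exponentially.\<close>

lemma flare_grows:
  fixes u :: "nat \<Rightarrow> real"
  assumes flare: "\<And>k. lam * u (Suc k) \<le> max (u (Suc (Suc k))) (u k)"
    and lam: "lam > 1" and u: "\<And>k. 0 \<le> u k"
    and m: "u m < lam * u (Suc m)"
  shows "lam ^ i * u (Suc m) \<le> u (Suc m + i)" "lam * u (Suc m + i) \<le> u (Suc (Suc m + i))"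
proof -
  have pos: "0 < lam * u (Suc m)"
    using m u[of m] by linarith
  \<comment> \<open>Once \<open>u k\<close> is too small to realise the maximum in the flare
    inequality, the term two steps later must realise it; since \<open>lam > 1\<close> the same
    situation recurs at the next index. Positivity is carried along because it makes the comparison
    with \<open>lam\<close> strict.\<close>
  have step: "u (Suc m + i) < lam * u (Suc (Suc m + i)) \<and> lam * u (Suc m + i) \<le> u (Suc (Suc m + i))
      \<and> 0 < u (Suc m + i)" for i
  proof (induction i)
    case 0
    have p: "0 < u (Suc m)"
      using pos lam by (simp add: zero_less_mult_iff)
    have *: "lam * u (Suc m) \<le> u (Suc (Suc m))"
      using flare[of m] m by simp
    moreover have "u (Suc m) < lam * u (Suc m)" "u (Suc (Suc m)) \<le> lam * u (Suc (Suc m))"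
      using p lam u[of "Suc (Suc m)"] mult_right_mono[of 1 lam "u (Suc (Suc m))"] by auto
    ultimately have "u (Suc m) < lam * u (Suc (Suc m))"
      by linarith
    with * p show ?case
      by simp
  next
    case (Suc i)
    let ?k = "Suc m + i"
    have p: "0 < u (Suc ?k)"
      using Suc lam by (smt (verit) mult_less_cancel_right1)
    have *: "lam * u (Suc ?k) \<le> u (Suc (Suc ?k))"
      using flare[of ?k] Suc by (auto simp: le_max_iff_disj)
    moreover have "u (Suc ?k) < lam * u (Suc ?k)" "u (Suc (Suc ?k)) \<le> lam * u (Suc (Suc ?k))"
      using p lam u[of "Suc (Suc ?k)"] mult_right_mono[of 1 lam "u (Suc (Suc ?k))"] by auto
    ultimately have "u (Suc ?k) < lam * u (Suc (Suc ?k))"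
      by linarith
    with * p show ?case
      by simp
  qed
  show "lam * u (Suc m + i) \<le> u (Suc (Suc m + i))"
    using step by blast
  show "lam ^ i * u (Suc m) \<le> u (Suc m + i)"
  proof (induction i)
    case (Suc i)
    have "lam ^ Suc i * u (Suc m) = lam * (lam ^ i * u (Suc m))"
      by simp
    also have "\<dots> \<le> lam * u (Suc m + i)"
      using Suc lam by (intro mult_left_mono) auto
    also have "\<dots> \<le> u (Suc m + Suc i)"
      using step[of i] by simp
    finally show ?case .
  qed simp
qed

lemma flare_decays:
  fixes u :: "nat \<Rightarrow> real"
  assumes "\<And>k. k < n \<Longrightarrow> lam * u (Suc k) \<le> u k" "0 \<le> lam"
  shows "lam ^ n * u n \<le> u 0"
  using assms(1)
proof (induction n)
  case (Suc n)
  have "lam ^ Suc n * u (Suc n) = lam ^ n * (lam * u (Suc n))"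
    by simp
  also have "\<dots> \<le> lam ^ n * u n"
    using Suc.prems[of n] assms(2) by (intro mult_left_mono) auto
  also have "\<dots> \<le> u 0"
    using Suc by simp
  finally show ?case .
qed simp

lemma eventually_mult_power_less:
  fixes \<mu> lam :: real
  assumes "0 < \<mu>" "\<mu> < lam" "0 < r"
  shows "\<forall>\<^sub>F j in sequentially. C * \<mu> ^ j < r * lam ^ j"
proof -
  have "(\<lambda>j. C * (\<mu> / lam) ^ j) \<longlonglongrightarrow> C * 0"
    using assms by (intro tendsto_mult tendsto_const LIMSEQ_power_zero) auto
  then have "\<forall>\<^sub>F j in sequentially. C * (\<mu> / lam) ^ j < r"
    using assms by (intro order_tendstoD) auto
  then show ?thesis
    using assms by (simp add: power_divide field_simps)
qed

text \<open>Used twice: for \<open>Aop\<close> on the edges off \<open>H\<close> and for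
  \<open>Lop\<close> on all levels. Linearity is asked on arbitrary functions, which holds there
  because both operators are given by finite sums in each coordinate.\<close>

locale l2_operator =
  fixes D :: "'a set" and A :: "('a \<Rightarrow> complex) \<Rightarrow> 'a \<Rightarrow> complex" and B :: real
  assumes A_l2: "x \<in> l2 D \<Longrightarrow> A x \<in> l2 D"
    and A_bound: "x \<in> l2 D \<Longrightarrow> nrm (A x) \<le> B * nrm x"
    and A_add: "A (\<lambda>a. x a + y a) = (\<lambda>a. A x a + A y a)"
    and A_scale: "A (\<lambda>a. c * x a) = (\<lambda>a. c * A x a)"
begin

lemma pow_l2: "x \<in> l2 D \<Longrightarrow> (A ^^ k) x \<in> l2 D"
  by (induction k) (auto intro: A_l2)

lemma pow_add: "(A ^^ k) (\<lambda>a. x a + y a) = (\<lambda>a. (A ^^ k) x a + (A ^^ k) y a)"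
  by (induction k) (auto simp: A_add)

lemma pow_scale: "(A ^^ k) (\<lambda>a. c * x a) = (\<lambda>a. c * (A ^^ k) x a)"
  by (induction k) (auto simp: A_scale)

lemma A_diff: "A (\<lambda>a. x a - y a) = (\<lambda>a. A x a - A y a)"
  using A_add[of x "\<lambda>a. -1 * y a"] A_scale[of "-1" y] by simp

lemma tendsto_A:
  assumes "\<And>j::nat. s j \<in> l2 D" "x \<in> l2 D" "(\<lambda>j. nrm (\<lambda>a. s j a - x a)) \<longlonglongrightarrow> 0"
  shows "(\<lambda>j. nrm (A (s j))) \<longlonglongrightarrow> nrm (A x)"
proof (rule tendsto_nrm)
  have "nrm (\<lambda>a. A (s j) a - A x a) \<le> B * nrm (\<lambda>a. s j a - x a)" for j
    using A_bound[OF l2_diff[OF assms(1)[of j] assms(2)]] by (simp add: A_diff)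
  then show "(\<lambda>j. nrm (\<lambda>a. A (s j) a - A x a)) \<longlonglongrightarrow> 0"
    by (intro Lim_null_comparison[OF always_eventually tendsto_mult_right_zero[OF assms(3), of B]]) simp
qed (auto intro: A_l2 assms)

text \<open>The preimages \<open>z\<close> are chosen separately for each \<open>k\<close>; they
  need not form one backward orbit.\<close>

definition bounded_orbit :: "real \<Rightarrow> ('a \<Rightarrow> complex) \<Rightarrow> bool" where
  "bounded_orbit c x \<longleftrightarrow> x \<in> l2 D \<and>
     (\<forall>k. nrm ((A ^^ k) x) \<le> c \<and> (\<exists>z\<in>l2 D. nrm z \<le> c \<and> (A ^^ k) z = x))"

lemma bounded_orbit_l2: "bounded_orbit c x \<Longrightarrow> x \<in> l2 D"
  by (simp add: bounded_orbit_def)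

lemma bounded_orbit_mono: "bounded_orbit c x \<Longrightarrow> c \<le> d \<Longrightarrow> bounded_orbit d x"
  unfolding bounded_orbit_def by (meson order_trans)

lemma pow_zero: "(A ^^ k) (\<lambda>_. 0) = (\<lambda>_. 0)"
  using pow_scale[of k 0 "\<lambda>_. 0"] by simp

lemma bounded_orbit_zero: "bounded_orbit 0 (\<lambda>_. 0)"
  by (auto simp: bounded_orbit_def pow_zero intro!: bexI[of _ "\<lambda>_. 0"])

lemma bounded_orbit_add:
  assumes "bounded_orbit c x" "bounded_orbit d y"
  shows "bounded_orbit (c + d) (\<lambda>a. x a + y a)"
  unfolding bounded_orbit_def
proof (intro conjI allI)
  have l2: "x \<in> l2 D" "y \<in> l2 D"
    using assms by (auto intro: bounded_orbit_l2)
  then show "(\<lambda>a. x a + y a) \<in> l2 D"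
    by (rule l2_add)
  fix k
  have "nrm (\<lambda>a. (A ^^ k) x a + (A ^^ k) y a) \<le> nrm ((A ^^ k) x) + nrm ((A ^^ k) y)"
    by (intro nrm_add_le[where D = D] pow_l2 l2)
  also have "\<dots> \<le> c + d"
    using assms by (auto simp: bounded_orbit_def intro: add_mono)
  finally show "nrm ((A ^^ k) (\<lambda>a. x a + y a)) \<le> c + d"
    by (simp add: pow_add)
  obtain z w where zw: "z \<in> l2 D" "nrm z \<le> c" "(A ^^ k) z = x" "w \<in> l2 D" "nrm w \<le> d" "(A ^^ k) w = y"
    using assms by (metis bounded_orbit_def)
  show "\<exists>z\<in>l2 D. nrm z \<le> c + d \<and> (A ^^ k) z = (\<lambda>a. x a + y a)"
    using zw nrm_add_le[OF zw(1,4)] by (intro bexI[of _ "\<lambda>a. z a + w a"] l2_add) (auto simp: pow_add)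
qed

lemma bounded_orbit_scale:
  assumes "bounded_orbit c x"
  shows "bounded_orbit (cmod q * c) (\<lambda>a. q * x a)"
  unfolding bounded_orbit_def
proof (intro conjI allI)
  show "(\<lambda>a. q * x a) \<in> l2 D"
    using assms by (intro l2_scale bounded_orbit_l2)
  fix k
  show "nrm ((A ^^ k) (\<lambda>a. q * x a)) \<le> cmod q * c"
    using assms by (simp add: pow_scale nrm_scale bounded_orbit_def mult_left_mono)
  obtain z where z: "z \<in> l2 D" "nrm z \<le> c" "(A ^^ k) z = x"
    using assms by (metis bounded_orbit_def)
  then show "\<exists>z\<in>l2 D. nrm z \<le> cmod q * c \<and> (A ^^ k) z = (\<lambda>a. q * x a)"
    by (intro bexI[of _ "\<lambda>a. q * z a"] l2_scale) (auto simp: pow_scale nrm_scale mult_left_mono)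
qed

text \<open>The diagonal argument: \<open>s j\<close> is nearly optimal among all approximations
  with orbit bound \<open>real j\<close>, a set that always contains 0. Any fixed approximation is
  admissible for large \<open>j\<close>, so the distances tend to 0 while the bounds grow only
  linearly.\<close>

lemma bounded_orbit_approx:
  assumes "x \<in> lclosure D {s. \<exists>c. bounded_orbit c s}"
  obtains s where "\<And>j::nat. bounded_orbit (real j) (s j)" "(\<lambda>j. nrm (\<lambda>a. s j a - x a)) \<longlonglongrightarrow> 0"
proof -
  define dists where "dists j = (\<lambda>s. nrm (\<lambda>a. s a - x a)) ` {s. bounded_orbit (real j) s}" for j :: nat
  have bdd: "bdd_below (dists j)" for j
    by (auto simp: dists_def bdd_below_def intro: exI[of _ 0])
  have "\<exists>s. bounded_orbit (real j) s \<and> nrm (\<lambda>a. s a - x a) < Inf (dists j) + inverse (real (Suc j))" for j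
  proof -
    have "bounded_orbit (real j) (\<lambda>_. 0)"
      by (rule bounded_orbit_mono[OF bounded_orbit_zero]) simp
    then have ne: "dists j \<noteq> {}"
      by (auto simp: dists_def)
    have "Inf (dists j) < Inf (dists j) + inverse (real (Suc j))"
      by simp
    then show ?thesis
      using cInf_lessD[OF ne] unfolding dists_def by auto
  qed
  then obtain s where s: "\<And>j. bounded_orbit (real j) (s j)"
    "\<And>j. nrm (\<lambda>a. s j a - x a) < Inf (dists j) + inverse (real (Suc j))"
    by metis
  have "(\<lambda>j. nrm (\<lambda>a. s j a - x a)) \<longlonglongrightarrow> 0"
  proof (rule order_tendstoI)
    fix \<epsilon> :: real assume "0 < \<epsilon>"
    then have "0 < \<epsilon> / 2"
      by simp
    then have "\<exists>z\<in>{s. \<exists>c. bounded_orbit c s}. nrm (\<lambda>a. z a - x a) < \<epsilon> / 2"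
      using assms unfolding lclosure_iff by blast
    then obtain z c where z: "bounded_orbit c z" "nrm (\<lambda>a. z a - x a) < \<epsilon> / 2"
      by blast
    have "\<forall>\<^sub>F j in sequentially. inverse (real (Suc j)) < \<epsilon> / 2"
      using \<open>0 < \<epsilon>\<close> by (intro order_tendstoD[OF LIMSEQ_inverse_real_of_nat]) auto
    moreover have "\<forall>\<^sub>F j in sequentially. c \<le> real j"
      using filterlim_real_sequentially by (simp add: filterlim_at_top)
    ultimately show "\<forall>\<^sub>F j in sequentially. nrm (\<lambda>a. s j a - x a) < \<epsilon>"
    proof eventually_elim
      case (elim j)
      then have "nrm (\<lambda>a. z a - x a) \<in> dists j"
        using bounded_orbit_mono[OF z(1)] by (auto simp: dists_def)
      then have "Inf (dists j) \<le> nrm (\<lambda>a. z a - x a)"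
        by (intro cInf_lower bdd)
      with s(2)[of j] z(2) elim show ?case
        by linarith
    qed
  qed (auto intro: always_eventually less_le_trans[OF _ nrm_nonneg])
  with s(1) that show thesis by blast
qed

text \<open>The same sequence \<open>s\<close> serves both spaces: directly for
  \<open>frakE\<close>, and through preimages of \<open>s j\<close> under \<open>A ^^ j\<close> for
  \<open>frakF\<close>. Since \<open>frakF\<close> inverts its parameter,
  \<open>inverse \<nu>\<close> again allows growth at rate \<nu>.\<close>

lemma frakE_frakF_of_bounded_orbits:
  assumes "x \<in> lclosure D {s. \<exists>c. bounded_orbit c s}" "1 \<le> \<nu>"
  shows "x \<in> frakE D A \<nu>" "x \<in> frakF D A (inverse \<nu>)"
proof -
  obtain s where s: "\<And>j::nat. bounded_orbit (real j) (s j)" "(\<lambda>j. nrm (\<lambda>a. s j a - x a)) \<longlonglongrightarrow> 0"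
    using bounded_orbit_approx[OF assms(1)] by blast
  have x: "x \<in> l2 D"
    using assms(1) by (rule lclosure_l2)
  have "nrm ((A ^^ j) (s j)) \<le> real j" "s j \<in> l2 D" for j
    using s(1)[of j] by (auto simp: bounded_orbit_def)
  with x s(2) assms(2) show "x \<in> frakE D A \<nu>"
    unfolding frakE_def by (auto intro!: exI[of _ s] limsup_root_le_of_le_id)
  have "\<forall>j. \<exists>z\<in>l2 D. nrm z \<le> real j \<and> (A ^^ j) z = s j"
    using s(1) by (auto simp: bounded_orbit_def)
  then obtain z where "\<And>j. z j \<in> l2 D" "\<And>j. nrm (z j) \<le> real j" "\<And>j. (A ^^ j) (z j) = s j"
    by metis
  with x s(2) assms(2) show "x \<in> frakF D A (inverse \<nu>)"
    unfolding frakF_def by (auto intro!: exI[of _ z] limsup_root_le_of_le_id)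
qed

text \<open>Both spectral conditions at once, with the limsup of roots replaced by a bound
  \<open>C * \<mu> ^ j\<close>. The free constant makes closure under sums and scalar multiples
  immediate.\<close>

definition slow :: "real \<Rightarrow> ('a \<Rightarrow> complex) \<Rightarrow> bool" where
  "slow \<mu> x \<longleftrightarrow> x \<in> l2 D \<and>
     (\<exists>s C. (\<forall>j. s j \<in> l2 D) \<and> (\<lambda>j. nrm (\<lambda>a. s j a - x a)) \<longlonglongrightarrow> 0
        \<and> (\<forall>\<^sub>F j in sequentially. nrm ((A ^^ j) (s j)) \<le> C * \<mu> ^ j)) \<and>
     (\<exists>s C. (\<forall>j. s j \<in> l2 D) \<and> (\<lambda>j. nrm (\<lambda>a. (A ^^ j) (s j) a - x a)) \<longlonglongrightarrow> 0
        \<and> (\<forall>\<^sub>F j in sequentially. nrm (s j) \<le> C * \<mu> ^ j))"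

lemma slow_l2: "slow \<mu> x \<Longrightarrow> x \<in> l2 D"
  by (simp add: slow_def)

lemma slowE:
  assumes "slow \<mu> x"
  obtains s C t C' where
    "\<forall>j. s j \<in> l2 D" "(\<lambda>j. nrm (\<lambda>a. s j a - x a)) \<longlonglongrightarrow> 0"
    "\<forall>\<^sub>F j in sequentially. nrm ((A ^^ j) (s j)) \<le> C * \<mu> ^ j"
    "\<forall>j. t j \<in> l2 D" "(\<lambda>j. nrm (\<lambda>a. (A ^^ j) (t j) a - x a)) \<longlonglongrightarrow> 0"
    "\<forall>\<^sub>F j in sequentially. nrm (t j) \<le> C' * \<mu> ^ j"
proof -
  note * = conjunct2[OF assms[unfolded slow_def]]
  from conjunct1[OF *] obtain s C where s: "\<forall>j. s j \<in> l2 D"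
    "(\<lambda>j. nrm (\<lambda>a. s j a - x a)) \<longlonglongrightarrow> 0"
    "\<forall>\<^sub>F j in sequentially. nrm ((A ^^ j) (s j)) \<le> C * \<mu> ^ j"
    by (elim exE conjE) (rule that; assumption)
  from conjunct2[OF *] obtain t C' where t: "\<forall>j. t j \<in> l2 D"
    "(\<lambda>j. nrm (\<lambda>a. (A ^^ j) (t j) a - x a)) \<longlonglongrightarrow> 0"
    "\<forall>\<^sub>F j in sequentially. nrm (t j) \<le> C' * \<mu> ^ j"
    by (elim exE conjE) (rule that; assumption)
  show thesis
    by (rule that[OF s t])
qed

lemma slowI:
  assumes "x \<in> l2 D" "\<And>j. s j \<in> l2 D" "(\<lambda>j. nrm (\<lambda>a. s j a - x a)) \<longlonglongrightarrow> 0"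
    "\<forall>\<^sub>F j in sequentially. nrm ((A ^^ j) (s j)) \<le> C * \<mu> ^ j"
    "\<And>j. t j \<in> l2 D" "(\<lambda>j. nrm (\<lambda>a. (A ^^ j) (t j) a - x a)) \<longlonglongrightarrow> 0"
    "\<forall>\<^sub>F j in sequentially. nrm (t j) \<le> C' * \<mu> ^ j"
  shows "slow \<mu> x"
  unfolding slow_def
  by (intro conjI exI[of _ s] exI[of _ C] exI[of _ t] exI[of _ C'] allI assms)

lemma slow_bounded_orbit:
  assumes "bounded_orbit c x" "1 \<le> \<mu>"
  shows "slow \<mu> x"
proof -
  have c: "0 \<le> c"
    using assms(1) unfolding bounded_orbit_def by (meson nrm_nonneg order_trans)
  have le: "u \<le> c * \<mu> ^ j" if "u \<le> c" for u and j :: nat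
    using that mult_left_mono[OF one_le_power[OF assms(2), of j] c] by simp
  have "\<forall>j. \<exists>z\<in>l2 D. nrm z \<le> c \<and> (A ^^ j) z = x"
    using assms(1) by (auto simp: bounded_orbit_def)
  then obtain z where "\<And>j. z j \<in> l2 D" "\<And>j. nrm (z j) \<le> c" "\<And>j. (A ^^ j) (z j) = x"
    by metis
  then show ?thesis
    using assms(1) by (intro slowI[where s = "\<lambda>_. x" and t = z and C = c and C' = c])
      (auto simp: bounded_orbit_def intro!: always_eventually le)
qed

lemma slow_add:
  assumes "slow \<mu> x" "slow \<mu> y"
  shows "slow \<mu> (\<lambda>a. x a + y a)"
proof -
  obtain s C t C' where x_raw:
    "\<forall>j. s j \<in> l2 D" "(\<lambda>j. nrm (\<lambda>a. s j a - x a)) \<longlonglongrightarrow> 0"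
    "\<forall>\<^sub>F j in sequentially. nrm ((A ^^ j) (s j)) \<le> C * \<mu> ^ j"
    "\<forall>j. t j \<in> l2 D" "(\<lambda>j. nrm (\<lambda>a. (A ^^ j) (t j) a - x a)) \<longlonglongrightarrow> 0"
    "\<forall>\<^sub>F j in sequentially. nrm (t j) \<le> C' * \<mu> ^ j"
    using assms(1) by (rule slowE)
  note x = x_raw[rule_format]
  obtain s' E t' E' where y_raw:
    "\<forall>j. s' j \<in> l2 D" "(\<lambda>j. nrm (\<lambda>a. s' j a - y a)) \<longlonglongrightarrow> 0"
    "\<forall>\<^sub>F j in sequentially. nrm ((A ^^ j) (s' j)) \<le> E * \<mu> ^ j"
    "\<forall>j. t' j \<in> l2 D" "(\<lambda>j. nrm (\<lambda>a. (A ^^ j) (t' j) a - y a)) \<longlonglongrightarrow> 0"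
    "\<forall>\<^sub>F j in sequentially. nrm (t' j) \<le> E' * \<mu> ^ j"
    using assms(2) by (rule slowE)
  note y = y_raw[rule_format]
  have l2: "x \<in> l2 D" "y \<in> l2 D"
    using assms by (auto intro: slow_l2)
  show ?thesis
  proof (rule slowI)
    show "(\<lambda>a. x a + y a) \<in> l2 D"
      using l2 by (rule l2_add)
    show "(\<lambda>a. s j a + s' j a) \<in> l2 D" "(\<lambda>a. t j a + t' j a) \<in> l2 D" for j
      using x y by (auto intro: l2_add)
    show "(\<lambda>j. nrm (\<lambda>a. s j a + s' j a - (x a + y a))) \<longlonglongrightarrow> 0"
      using x y l2 by (intro tendsto_nrm_add)
    show "(\<lambda>j. nrm (\<lambda>a. (A ^^ j) (\<lambda>a. t j a + t' j a) a - (x a + y a))) \<longlonglongrightarrow> 0"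
      unfolding pow_add by (intro tendsto_nrm_add[where D = D] pow_l2 x y l2)
    show "\<forall>\<^sub>F j in sequentially. nrm ((A ^^ j) (\<lambda>a. s j a + s' j a)) \<le> (C + E) * \<mu> ^ j"
      unfolding pow_add using x(3) y(3) by (rule eventually_add_power_le) (intro nrm_add_le[where D = D] pow_l2 x y)
    show "\<forall>\<^sub>F j in sequentially. nrm (\<lambda>a. t j a + t' j a) \<le> (C' + E') * \<mu> ^ j"
      using x(6) y(6) by (rule eventually_add_power_le) (intro nrm_add_le[where D = D] x y)
  qed
qed

lemma slow_scale:
  assumes "slow \<mu> x"
  shows "slow \<mu> (\<lambda>a. c * x a)"
proof -
  obtain s C t C' where x_raw:
    "\<forall>j. s j \<in> l2 D" "(\<lambda>j. nrm (\<lambda>a. s j a - x a)) \<longlonglongrightarrow> 0"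
    "\<forall>\<^sub>F j in sequentially. nrm ((A ^^ j) (s j)) \<le> C * \<mu> ^ j"
    "\<forall>j. t j \<in> l2 D" "(\<lambda>j. nrm (\<lambda>a. (A ^^ j) (t j) a - x a)) \<longlonglongrightarrow> 0"
    "\<forall>\<^sub>F j in sequentially. nrm (t j) \<le> C' * \<mu> ^ j"
    using assms by (rule slowE)
  note x = x_raw[rule_format]
  have diff: "nrm (\<lambda>a. c * u a - c * v a) = cmod c * nrm (\<lambda>a. u a - v a)" for u v :: "'a \<Rightarrow> complex"
    by (simp add: nrm_scale flip: right_diff_distrib)
  show ?thesis
  proof (rule slowI)
    show "(\<lambda>a. c * x a) \<in> l2 D"
      using assms by (intro l2_scale slow_l2)
    show "(\<lambda>a. c * s j a) \<in> l2 D" "(\<lambda>a. c * t j a) \<in> l2 D" for j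
      using x by (auto intro: l2_scale)
    show "(\<lambda>j. nrm (\<lambda>a. c * s j a - c * x a)) \<longlonglongrightarrow> 0"
      unfolding diff using tendsto_mult[OF tendsto_const x(2)] by simp
    show "(\<lambda>j. nrm (\<lambda>a. (A ^^ j) (\<lambda>a. c * t j a) a - c * x a)) \<longlonglongrightarrow> 0"
      unfolding diff pow_scale using tendsto_mult[OF tendsto_const x(5)] by simp
    show "\<forall>\<^sub>F j in sequentially. nrm ((A ^^ j) (\<lambda>a. c * s j a)) \<le> (cmod c * C) * \<mu> ^ j"
      unfolding pow_scale nrm_scale using x(3) by eventually_elim (simp add: mult.assoc mult_left_mono)
    show "\<forall>\<^sub>F j in sequentially. nrm (\<lambda>a. c * t j a) \<le> (cmod c * C') * \<mu> ^ j"
      unfolding nrm_scale using x(6) by eventually_elim (simp add: mult.assoc mult_left_mono)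
  qed
qed

lemma slow_repart:
  assumes A_repart: "\<And>x. A (repart x) = repart (A x)"
    and "slow \<mu> x"
  shows "slow \<mu> (repart x)"
proof -
  have pow: "(A ^^ k) (repart x) = repart ((A ^^ k) x)" for k x
    by (induction k) (auto simp: A_repart)
  obtain s C t C' where x_raw:
    "\<forall>j. s j \<in> l2 D" "(\<lambda>j. nrm (\<lambda>a. s j a - x a)) \<longlonglongrightarrow> 0"
    "\<forall>\<^sub>F j in sequentially. nrm ((A ^^ j) (s j)) \<le> C * \<mu> ^ j"
    "\<forall>j. t j \<in> l2 D" "(\<lambda>j. nrm (\<lambda>a. (A ^^ j) (t j) a - x a)) \<longlonglongrightarrow> 0"
    "\<forall>\<^sub>F j in sequentially. nrm (t j) \<le> C' * \<mu> ^ j"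
    using assms(2) by (rule slowE)
  note x = x_raw[rule_format]
  have l2: "x \<in> l2 D"
    using assms by (intro slow_l2)
  show ?thesis
  proof (rule slowI)
    show "repart x \<in> l2 D"
      using l2 by (rule l2_repart)
    show "repart (s j) \<in> l2 D" "repart (t j) \<in> l2 D" for j
      using x by (auto intro: l2_repart)
    show "(\<lambda>j. nrm (\<lambda>a. repart (s j) a - repart x a)) \<longlonglongrightarrow> 0"
      by (rule Lim_null_comparison[OF _ x(2)]) (simp add: nrm_repart_diff_le[OF x(1) l2])
    show "(\<lambda>j. nrm (\<lambda>a. (A ^^ j) (repart (t j)) a - repart x a)) \<longlonglongrightarrow> 0"
      unfolding pow by (rule Lim_null_comparison[OF _ x(5)]) (simp add: nrm_repart_diff_le[OF pow_l2[OF x(4)] l2])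
    show "\<forall>\<^sub>F j in sequentially. nrm ((A ^^ j) (repart (s j))) \<le> C * \<mu> ^ j"
      unfolding pow using x(3) by eventually_elim (rule order_trans[OF nrm_repart_le[OF pow_l2[OF x(1)]]])
    show "\<forall>\<^sub>F j in sequentially. nrm (repart (t j)) \<le> C' * \<mu> ^ j"
      using x(6) by eventually_elim (rule order_trans[OF nrm_repart_le[OF x(4)]])
  qed
qed

text \<open>The vectors approximating \<^term>\<open>y\<close> whose forward orbits grow slowly must still be shrinking by the
flare factor at time 0; the orbits that start small and arrive near \<^term>\<open>y\<close> at time \<open>j\<close> must
already be growing by it at time \<open>j\<close>.\<close>

lemma slow_not_flaring:
  assumes slow: "slow \<mu> y" and \<mu>: "1 \<le> \<mu>" "\<mu> < lam"
    and y: "nrm y \<noteq> 0"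
    and \<delta>: "0 < \<delta>" "\<And>z. z \<in> l2 D \<Longrightarrow> nrm (\<lambda>a. z a - y a) < \<delta> \<Longrightarrow> z \<in> N"
    and flare: "\<And>x. x \<in> l2 D \<Longrightarrow> (\<exists>z\<in>N. \<exists>k. x = (A ^^ k) z) \<or> (\<exists>k. (A ^^ k) x \<in> N)
        \<Longrightarrow> lam * nrm (A x) \<le> max (nrm (A (A x))) (nrm x)"
  shows False
proof -
  obtain s C t C' where st_raw:
    "\<forall>j. s j \<in> l2 D" "(\<lambda>j. nrm (\<lambda>a. s j a - y a)) \<longlonglongrightarrow> 0"
    "\<forall>\<^sub>F j in sequentially. nrm ((A ^^ j) (s j)) \<le> C * \<mu> ^ j"
    "\<forall>j. t j \<in> l2 D" "(\<lambda>j. nrm (\<lambda>a. (A ^^ j) (t j) a - y a)) \<longlonglongrightarrow> 0"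
    "\<forall>\<^sub>F j in sequentially. nrm (t j) \<le> C' * \<mu> ^ j"
    using slow by (rule slowE)
  note st = st_raw[rule_format]
  have y2: "y \<in> l2 D"
    using slow by (rule slow_l2)
  have lam: "1 < lam"
    using \<mu> by simp
  define r where "r = nrm y / 2"
  have r: "0 < r" "r < nrm y"
    using y by (auto simp: r_def order_less_le)
  \<comment> \<open>Two factors \<open>lam\<close> are given away below: growth starts only at index
    1, and the norm there is only known to exceed the initial norm divided by
    \<open>lam\<close>.\<close>
  then have r2: "0 < r / lam\<^sup>2"
    using lam by simp
  have s_near: "\<forall>\<^sub>F j in sequentially. s j \<in> N"
    using order_tendstoD(2)[OF st(2) \<delta>(1)] by eventually_elim (intro \<delta>(2) st(1))
  have t_near: "\<forall>\<^sub>F j in sequentially. (A ^^ j) (t j) \<in> N"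
    using order_tendstoD(2)[OF st(5) \<delta>(1)] by eventually_elim (intro \<delta>(2) pow_l2 st(4))
  have s_big: "\<forall>\<^sub>F j in sequentially. r < nrm (s j)"
    and t_big: "\<forall>\<^sub>F j in sequentially. r < nrm ((A ^^ j) (t j))"
    using order_tendstoD(1)[OF tendsto_nrm[OF st(1) y2 st(2)] r(2)]
      order_tendstoD(1)[OF tendsto_nrm[OF pow_l2[OF st(4)] y2 st(5)] r(2)] by auto
  have power_less: "\<forall>\<^sub>F j in sequentially. E * \<mu> ^ j < q * lam ^ j" if "0 < q" for E q
    using that \<mu> by (intro eventually_mult_power_less) auto
  have "\<forall>\<^sub>F j in sequentially. lam * nrm (A (s j)) \<le> nrm (s j)"
    using s_near s_big st(3) power_less[OF r2, of C] eventually_ge_at_top[of 1]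
  proof eventually_elim
    case (elim j)
    define u where "u k = nrm ((A ^^ k) (s j))" for k
    have fl: "lam * u (Suc k) \<le> max (u (Suc (Suc k))) (u k)" for k
      unfolding u_def using flare[of "(A ^^ k) (s j)"] elim(1) pow_l2[OF st(1)] by auto
    show ?case
    proof (rule ccontr)
      assume "\<not> ?case"
      then have gr: "u 0 < lam * u (Suc 0)"
        by (simp add: u_def)
      have "lam ^ (j - 1) * u (Suc 0) \<le> u j"
        using flare_grows(1)[of lam u 0 "j - 1", OF fl lam _ gr] elim(5) by (simp add: u_def)
      then have "lam\<^sup>2 * (lam ^ (j - 1) * u (Suc 0)) \<le> lam\<^sup>2 * u j"
        by (intro mult_left_mono) auto
      moreover have "lam\<^sup>2 * (lam ^ (j - 1) * u (Suc 0)) = lam ^ j * (lam * u (Suc 0))"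
        using elim(5) by (cases j) (auto simp: power2_eq_square)
      moreover have "lam ^ j * r \<le> lam ^ j * (lam * u (Suc 0))"
        using gr elim(2) lam by (intro mult_left_mono) (auto simp: u_def)
      moreover have "u j < r / lam\<^sup>2 * lam ^ j"
        using elim(3,4) by (simp add: u_def)
      then have "lam\<^sup>2 * u j < lam ^ j * r"
        using lam by (simp add: field_simps)
      ultimately show False
        by linarith
    qed
  qed
  then have "lam * nrm (A y) \<le> nrm y"
    using tendsto_le[OF sequentially_bot tendsto_nrm[OF st(1) y2 st(2)]
        tendsto_mult[OF tendsto_const[of lam] tendsto_A[OF st(1) y2 st(2)]]] by blast
  moreover
  have "\<forall>\<^sub>F j in sequentially. lam * nrm ((A ^^ j) (t j)) \<le> nrm (A ((A ^^ j) (t j)))"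
    using t_near t_big st(6) power_less[OF r(1), of C']
  proof eventually_elim
    case (elim j)
    define u where "u k = nrm ((A ^^ k) (t j))" for k
    \<comment> \<open>Both halves of the saturation of \<open>N\<close> are needed: iterates up to
      time \<open>j\<close> are carried into \<open>N\<close> by the remaining \<open>j - k\<close>
      steps, and later ones are images of a vector of \<open>N\<close>.\<close>
    have fl: "lam * u (Suc k) \<le> max (u (Suc (Suc k))) (u k)" for k
    proof -
      have "(A ^^ k) (t j) = (A ^^ (k - j)) ((A ^^ j) (t j))" if "j \<le> k"
        using that by (simp flip: funpow_add comp_apply[of "A ^^ (k - j)"])
      moreover have "(A ^^ (j - k)) ((A ^^ k) (t j)) = (A ^^ j) (t j)" if "k \<le> j"
        using that by (simp flip: funpow_add comp_apply[of "A ^^ (j - k)"])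
      ultimately show ?thesis
        unfolding u_def using flare[of "(A ^^ k) (t j)"] elim(1) pow_l2[OF st(4)]
        by (metis funpow.simps(2) comp_apply linear)
    qed
    \<comment> \<open>If the orbit shrank by \<open>lam\<close> at every step before
      \<open>j\<close>, its initial norm would be at least \<open>lam ^ j * r\<close>, which exceeds
      the bound \<open>C' * \<mu> ^ j\<close>.\<close>
    have "\<exists>m<j. u m < lam * u (Suc m)"
    proof (rule ccontr)
      assume "\<not> ?thesis"
      then have "lam ^ j * u j \<le> u 0"
        using flare_decays[of j lam u] lam by fastforce
      moreover have "lam ^ j * r \<le> lam ^ j * u j"
        using elim(2) lam by (intro mult_left_mono) (auto simp: u_def)
      ultimately show False
        using elim(3,4) by (simp add: u_def mult.commute)
    qed
    then obtain m where m: "m < j" "u m < lam * u (Suc m)"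
      by blast
    then have "lam * u j \<le> u (Suc j)"
      using flare_grows(2)[of lam u m "j - Suc m", OF fl lam _ m(2)] by (simp add: u_def)
    then show ?case
      by (simp add: u_def)
  qed
  then have "lam * nrm y \<le> nrm (A y)"
    using tendsto_le[OF sequentially_bot tendsto_A[OF pow_l2[OF st(4)] y2 st(5)]
        tendsto_mult[OF tendsto_const[of lam] tendsto_nrm[OF pow_l2[OF st(4)] y2 st(5)]]] by blast
  ultimately have "lam * (lam * nrm y) \<le> nrm y"
    using lam by (meson mult_left_mono order_trans less_imp_le zero_less_one less_trans)
  moreover have "1 * nrm y < (lam * lam) * nrm y"
    using less_1_mult[OF lam lam] r by (intro mult_strict_right_mono) (simp, linarith)
  ultimately show False
    by simp
qed

end

section \<open>The chain map of a graph map\<close>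

text \<open>The paper's \<open>\<pi>\<^sub>H\<^sup>\<bottom>\<close> applied to the chain of a lifted path.\<close>

definition projchain :: "('v, 'e) gsetup \<Rightarrow> 'e epath \<Rightarrow> 'e epath \<Rightarrow> 'e epath \<times> 'e \<Rightarrow> complex" where
  "projchain S q s = (\<lambda>a. if a \<in> Eoff S then of_int (liftchain q s a) else 0)"

text \<open>The support of row \<open>b\<close> in the matrix of \<open>Aop\<close>; its finiteness
  turns the infinite sum in \<open>Aop\<close> into a finite one.\<close>

definition chrow :: "('v, 'e) gsetup \<Rightarrow> 'e epath \<times> 'e \<Rightarrow> ('e epath \<times> 'e) set" where
  "chrow S b = (if b \<in> Eoff S then {a \<in> Eoff S. chmap S a b \<noteq> 0} else {})"

lemma Eoff_iff: "(p, e) \<in> Eoff S \<longleftrightarrow>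
    reduced_path p \<and> gpath S (gbase S) p (gsrc S e) \<and> e \<in> gE S \<and> e \<notin> gHE S"
  by (auto simp: Eoff_def cedges_def Hedges_t_def cverts_def)

lemma projchain_Nil: "projchain S q [] = (\<lambda>_. 0)"
  by (auto simp: projchain_def)

lemma projchain_append:
  assumes "reduced_path q"
  shows "projchain S q (p @ s) = (\<lambda>a. projchain S q p a + projchain S (reduce (q @ p)) s a)"
  by (simp add: projchain_def liftchain_append[OF assms] fun_eq_iff)

lemma projchain_pinv:
  assumes "reduced_path q"
  shows "projchain S q (pinv s) = (\<lambda>a. -1 * projchain S (reduce (q @ pinv s)) s a)"
  by (simp add: projchain_def liftchain_pinv[OF assms] fun_eq_iff)

lemma projchain_reduce:
  "reduced_path q \<Longrightarrow> projchain S q (reduce s) = projchain S q s"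
  by (simp add: projchain_def liftchain_reduce fun_eq_iff)

text \<open>At most \<open>length s\<close> edges occur, each with coefficient at most
  \<open>length s\<close> in absolute value. The crude bound is enough because it does not involve
  \<open>q\<close>, so that all translates of a chain share it.\<close>

lemma
  shows l2_projchain: "projchain S q s \<in> l2 (Eoff S)"
    and nrm_projchain_le: "nrm (projchain S q s) \<le> real (length s * length s)"
proof -
  let ?B = "{a. liftchain q s a \<noteq> 0}"
  have "L2_set (\<lambda>a. cmod (projchain S q s a)) F \<le> real (length s * length s)" if F: "finite F" for F
  proof -
    have "L2_set (\<lambda>a. cmod (projchain S q s a)) F \<le> (\<Sum>a\<in>F. cmod (projchain S q s a))"
      by (rule L2_set_le_sum) auto
    also have "\<dots> = (\<Sum>a\<in>F \<inter> ?B. cmod (projchain S q s a))"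
      using F by (intro sum.mono_neutral_right) (auto simp: projchain_def)
    also have "\<dots> \<le> (\<Sum>a\<in>F \<inter> ?B. real (length s))"
    proof (rule sum_mono)
      fix a
      have "\<bar>real_of_int (liftchain q s a)\<bar> \<le> real (length s)"
        using abs_liftchain_le[of q s a] by linarith
      then show "cmod (projchain S q s a) \<le> real (length s)"
        by (simp add: projchain_def)
    qed
    also have "\<dots> = real (card (F \<inter> ?B) * length s)"
      by simp
    also have "\<dots> \<le> real (length s * length s)"
      using card_mono[of ?B "F \<inter> ?B"] liftchain_support[of q s]
      by (intro of_nat_mono mult_right_mono) auto
    finally show ?thesis .
  qed
  moreover have "projchain S q s a = 0" if "a \<notin> Eoff S" for a
    using that by (simp add: projchain_def)
  ultimately show "projchain S q s \<in> l2 (Eoff S)"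
    "nrm (projchain S q s) \<le> real (length s * length s)"
    using l2_nrm_boundI[of "Eoff S" "projchain S q s"] by blast+
qed

locale graph_map =
  fixes S :: "('v, 'e) gsetup"
  assumes graph: "graph_ok S"
    and equiv: "homotopy_equiv S"
    and invariant: "invariant_subgraph S"
begin

section \<open>Paths in the graph and the fundamental group\<close>

lemma gpath_endpoints: "gpath S a p b \<Longrightarrow> a \<in> gV S \<and> b \<in> gV S"
proof (induction p arbitrary: a)
  case (Cons x p)
  then show ?case
    using graph by (cases x) (auto simp: graph_ok_def split: if_splits)
qed auto

lemma gpath_append: "gpath S a (p @ q) c \<longleftrightarrow> (\<exists>b. gpath S a p b \<and> gpath S b q c)"
proof (induction p arbitrary: a)
  case Nil
  then show ?case
    using gpath_endpoints[of a q c] by auto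
next
  case (Cons x p)
  then show ?case
    by (cases x) auto
qed

lemma gpath_pinv: "gpath S a p b \<Longrightarrow> gpath S b (pinv p) a"
proof (induction p arbitrary: a)
  case (Cons x p)
  obtain e d where x: "x = (e, d)"
    by fastforce
  let ?c = "if d then gtgt S e else gsrc S e"
  have "gpath S ?c p b" "gpath S ?c [linv x] a"
    using Cons.prems graph by (auto simp: x linv_Pair graph_ok_def split: if_splits)
  then show ?case
    using Cons.IH by (auto simp: pinv_Cons gpath_append)
qed auto

lemma gpath_reduce: "gpath S a p b \<Longrightarrow> gpath S a (reduce p) b"
proof (induction p arbitrary: a)
  case (Cons x p)
  obtain e d where x: "x = (e, d)"
    by fastforce
  let ?c = "if d then gtgt S e else gsrc S e"
  have "gpath S a (x # reduce p) b"
    using Cons by (auto simp: x split: if_splits)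
  moreover have "gpath S a (cancel_step x acc) b" if "gpath S a (x # acc) b" for acc
    using that by (cases acc) (auto simp: cancel_step_Cons x linv_Pair split: if_splits)
  ultimately show ?case
    by (simp add: reduce_Cons)
qed simp

lemma pi1_loop: "g \<in> pi1 S \<Longrightarrow> gpath S (gbase S) g (gbase S)"
  by (simp add: pi1_def)

lemma gpath_deck:
  "gpath S (gbase S) g (gbase S) \<Longrightarrow> gpath S (gbase S) p b \<Longrightarrow> gpath S (gbase S) (reduce (g @ p)) b"
  by (auto intro!: gpath_reduce simp: gpath_append)

lemma pi1_reduce: "gpath S (gbase S) g (gbase S) \<Longrightarrow> reduce g \<in> pi1 S"
  by (simp add: pi1_def gpath_reduce)

lemma Phi_pi1: "g \<in> pi1 S \<Longrightarrow> Phi S g \<in> pi1 S"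
  using equiv by (auto simp: homotopy_equiv_def bij_betw_def)

text \<open>The common end vertex makes \<open>p @ pinv q\<close> a loop, whose image under
  \<open>Phi\<close> is trivial by \<open>Phi_quotient\<close>; injectivity of \<open>Phi\<close> on
  the fundamental group makes the loop itself trivial.\<close>

lemma ftil_inj:
  assumes "reduced_path p" "reduced_path q" "gpath S (gbase S) p b" "gpath S (gbase S) q b"
    and "ftil S p = ftil S q"
  shows "p = q"
proof -
  have "reduce (p @ pinv q) \<in> pi1 S"
    using assms gpath_pinv by (intro pi1_reduce) (auto simp: gpath_append)
  moreover have "[] \<in> pi1 S"
    using graph by (simp add: pi1_def graph_ok_def)
  moreover have "Phi S (reduce (p @ pinv q)) = Phi S []"
    by (simp add: Phi_quotient assms(5)) (simp add: Phi_def)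
  ultimately have "reduce (p @ pinv q) = []"
    using equiv by (auto simp: homotopy_equiv_def bij_betw_def inj_on_def)
  then have "reduce (reduce (p @ pinv q) @ q) = q"
    using assms by (simp add: reduce_reduced)
  then show ?thesis
    using assms by (simp add: reduce_reduced)
qed

text \<open>An edge over \<^term>\<open>e\<close> whose image crosses \<^term>\<open>b\<close> at position \<^term>\<open>i\<close> is determined
by \<^term>\<open>e\<close>, \<^term>\<open>b\<close> and \<^term>\<open>i\<close>, because \<^const>\<open>ftil\<close> is injective on the fibres of the
universal cover.\<close>

lemma chmap_sparse:
  obtains K :: nat where
    "\<And>b. finite (chrow S b)" "\<And>b. card (chrow S b) \<le> K"
    "\<And>a. finite {b. a \<in> chrow S b}" "\<And>a. card {b. a \<in> chrow S b} \<le> K"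
    "\<And>a b. a \<in> chrow S b \<Longrightarrow> \<bar>chmap S a b\<bar> \<le> int K"
proof -
  define M where "M = (\<Sum>e\<in>gE S. length (gfE S e))"
  have fin: "finite (gE S)"
    using graph by (simp add: graph_ok_def)
  have len: "length (gfE S e) \<le> M" if "e \<in> gE S" for e
    unfolding M_def using that fin by (intro member_le_sum) auto
  \<comment> \<open>A row is counted by pairs of an edge and a position in its image, a column by
    the length of one image. The constant \<open>K\<close> is the sum of the two bounds and serves
    for both.\<close>
  define X where "X = gE S \<times> {..M}"
  define K where "K = card X + M"
  have row: "finite (chrow S b) \<and> card (chrow S b) \<le> card X" for b
  proof -
    \<comment> \<open>\<open>pos a i\<close> says that after \<open>i\<close> steps the image of the
      cover edge \<open>a\<close> stands at the initial vertex of \<open>b\<close>.\<close>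
    define pos where "pos a i \<longleftrightarrow> i \<le> length (gfE S (snd a)) \<and>
        fst b = reduce (ftil S (fst a) @ take i (gfE S (snd a)))" for a :: "'e epath \<times> 'e" and i
    have ex: "\<exists>i. pos a i" if "a \<in> chrow S b" for a
    proof -
      have "liftchain (ftil S (fst a)) (gfE S (snd a)) b \<noteq> 0"
        using that by (simp add: chrow_def chmap_def split: if_splits)
      from liftchain_nonzeroD[OF reduced_ftil this] show ?thesis
        by (auto simp: pos_def)
    qed
    have "inj_on (\<lambda>a. (snd a, SOME i. pos a i)) (chrow S b)"
    proof (rule inj_onI)
      fix a c assume a: "a \<in> chrow S b" and c: "c \<in> chrow S b"
        and eq: "(snd a, SOME i. pos a i) = (snd c, SOME i. pos c i)"
      define i where "i = (SOME i. pos a i)"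
      have "pos a i" "pos c i"
        using someI_ex[OF ex[OF a]] someI_ex[OF ex[OF c]] eq by (auto simp: i_def)
      define w where "w = take i (gfE S (snd a))"
      have e: "snd c = snd a"
        using eq by simp
      have "reduce (ftil S (fst a) @ w) = reduce (ftil S (fst c) @ w)"
        using \<open>pos a i\<close> \<open>pos c i\<close> by (simp add: pos_def e w_def)
      then have "reduce (reduce (ftil S (fst a) @ w) @ pinv w) = reduce (reduce (ftil S (fst c) @ w) @ pinv w)"
        by simp
      then have "ftil S (fst a) = ftil S (fst c)"
        by (simp add: reduce_reduced)
      moreover have "(fst a, snd a) \<in> Eoff S" "(fst c, snd c) \<in> Eoff S"
        using a c by (auto simp: chrow_def split: if_splits)
      ultimately have "fst a = fst c"
        unfolding Eoff_iff e by - (rule ftil_inj[where b = "gsrc S (snd a)"], simp_all)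
      with e show "a = c"
        by (simp add: prod_eq_iff)
    qed
    moreover have "(\<lambda>a. (snd a, SOME i. pos a i)) ` chrow S b \<subseteq> X"
    proof (rule image_subsetI)
      fix a assume a: "a \<in> chrow S b"
      then have "(fst a, snd a) \<in> Eoff S"
        by (auto simp: chrow_def split: if_splits)
      then have "snd a \<in> gE S"
        unfolding Eoff_iff by simp
      moreover have "(SOME i. pos a i) \<le> length (gfE S (snd a))"
        using someI_ex[OF ex[OF a]] by (simp add: pos_def)
      ultimately show "(snd a, SOME i. pos a i) \<in> X"
        using len order_trans by (auto simp: X_def)
    qed
    moreover have "finite X"
      using fin by (simp add: X_def)
    ultimately show ?thesis
      by (meson card_inj_on_le inj_on_finite)
  qed
  have edge: "snd a \<in> gE S" if "a \<in> Eoff S" for a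
    using that by (cases a) (simp add: Eoff_iff)
  have col: "finite {b. a \<in> chrow S b} \<and> card {b. a \<in> chrow S b} \<le> M" for a
  proof (cases "a \<in> Eoff S")
    case True
    let ?B = "{b. liftchain (ftil S (fst a)) (gfE S (snd a)) b \<noteq> 0}"
    have sub: "{b. a \<in> chrow S b} \<subseteq> ?B"
      by (auto simp: chrow_def chmap_def split: if_splits)
    have B: "finite ?B" "card ?B \<le> length (gfE S (snd a))"
      using liftchain_support by auto
    show ?thesis
      using finite_subset[OF sub B(1)] card_mono[OF B(1) sub] B(2) len[OF edge[OF True]] by linarith
  next
    case False
    then have empty: "{b. a \<in> chrow S b} = {}"
      by (auto simp: chrow_def split: if_splits)
    show ?thesis
      unfolding empty by simp
  qed
  have entry: "\<bar>chmap S a b\<bar> \<le> int M" if "a \<in> chrow S b" for a b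
  proof -
    have "a \<in> Eoff S"
      using that by (auto simp: chrow_def split: if_splits)
    then show ?thesis
      using abs_liftchain_le[of "ftil S (fst a)" "gfE S (snd a)" b] len[OF edge, of a]
      by (simp add: chmap_def)
  qed
  show thesis
  proof (rule that[of K])
    show "finite (chrow S b)" "card (chrow S b) \<le> K" for b
      using row[of b] by (auto simp: K_def)
    show "finite {b. a \<in> chrow S b}" "card {b. a \<in> chrow S b} \<le> K" for a
      using col[of a] by (auto simp: K_def)
    show "\<bar>chmap S a b\<bar> \<le> int K" if "a \<in> chrow S b" for a b
      using entry[OF that] by (simp add: K_def)
  qed
qed

lemma finite_chrow: "finite (chrow S b)"
  using chmap_sparse by blast

section \<open>The operators on square-summable chains as sparse matrices\<close>

lemma Aop_eq: "Aop S x = (\<lambda>b. \<Sum>a\<in>chrow S b. of_int (chmap S a b) * x a)"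
proof
  fix b
  show "Aop S x b = (\<Sum>a\<in>chrow S b. of_int (chmap S a b) * x a)"
  proof (cases "b \<in> Eoff S")
    case True
    have "(\<Sum>\<^sub>\<infinity>a\<in>Eoff S. x a * of_int (chmap S a b)) = (\<Sum>\<^sub>\<infinity>a\<in>chrow S b. x a * of_int (chmap S a b))"
      using True by (intro infsum_cong_neutral) (auto simp: chrow_def)
    with True show ?thesis
      using finite_chrow[of b] by (simp add: Aop_def mult.commute)
  qed (simp add: Aop_def chrow_def)
qed

lemma Lop_eq: "Lop S x =
    (\<lambda>p. \<Sum>q\<in>Pair (fst p - 1) ` chrow S (snd p). of_int (chmap S (snd q) (snd p)) * x q)"
proof
  fix p :: "int \<times> 'e epath \<times> 'e"
  show "Lop S x p = (\<Sum>q\<in>Pair (fst p - 1) ` chrow S (snd p). of_int (chmap S (snd q) (snd p)) * x q)"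
    by (subst sum.reindex) (auto simp: inj_on_def Lop_def Aop_eq split: prod.split)
qed

lemma Aop_operator: "\<exists>B. l2_operator (Eoff S) (Aop S) B"
proof -
  obtain K :: nat where K: "\<And>b. finite (chrow S b)" "\<And>b. card (chrow S b) \<le> K"
    "\<And>a. finite {b. a \<in> chrow S b}" "\<And>a. card {b. a \<in> chrow S b} \<le> K"
    "\<And>a b. a \<in> chrow S b \<Longrightarrow> \<bar>chmap S a b\<bar> \<le> int K"
    using chmap_sparse by metis
  \<comment> \<open>Entries outside the row supports are replaced by 0, since the Schur test asks
    for a bound on all of them.\<close>
  define m :: "'e epath \<times> 'e \<Rightarrow> 'e epath \<times> 'e \<Rightarrow> complex"
    where "m b a = (if a \<in> chrow S b then of_int (chmap S a b) else 0)" for b a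
  have m: "cmod (m b a) \<le> real K" for a b
    using K(5)[of a b] by (auto simp: m_def)
  have A: "Aop S x = (\<lambda>b. \<Sum>a\<in>chrow S b. m b a * x a)" for x
    unfolding Aop_eq by (intro ext sum.cong) (auto simp: m_def)
  have off: "chrow S b = {}" if "b \<notin> Eoff S" for b
    using that by (simp add: chrow_def)
  have "l2_operator (Eoff S) (Aop S) ((real K)\<^sup>2)"
  proof
    fix x assume x: "x \<in> l2 (Eoff S)"
    show "Aop S x \<in> l2 (Eoff S)"
      unfolding A by (rule sparse_l2[OF K(1-4) m x off])
    show "nrm (Aop S x) \<le> (real K)\<^sup>2 * nrm x"
      unfolding A by (rule nrm_sparse_le[OF K(1-4) m x off])
  qed (simp_all add: Aop_eq distrib_left distrib_right sum.distrib sum_distrib_left mult_ac)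
  then show ?thesis
    by blast
qed

text \<open>The matrix is that of \<open>Aop\<close>, copied from each level to the next, so the
  same \<open>K\<close> bounds rows, columns and entries.\<close>

lemma Lop_operator: "\<exists>B. l2_operator (UNIV \<times> Eoff S) (Lop S) B"
proof -
  obtain K :: nat where K: "\<And>b. finite (chrow S b)" "\<And>b. card (chrow S b) \<le> K"
    "\<And>a. finite {b. a \<in> chrow S b}" "\<And>a. card {b. a \<in> chrow S b} \<le> K"
    "\<And>a b. a \<in> chrow S b \<Longrightarrow> \<bar>chmap S a b\<bar> \<le> int K"
    using chmap_sparse by metis
  define R :: "int \<times> 'e epath \<times> 'e \<Rightarrow> (int \<times> 'e epath \<times> 'e) set"
    where "R p = Pair (fst p - 1) ` chrow S (snd p)" for p
  define m :: "int \<times> 'e epath \<times> 'e \<Rightarrow> int \<times> 'e epath \<times> 'e \<Rightarrow> complex"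
    where "m p q = (if q \<in> R p then of_int (chmap S (snd q) (snd p)) else 0)" for p q
  have m: "cmod (m p q) \<le> real K" for p q
  proof (cases "q \<in> R p")
    case True
    then have "\<bar>chmap S (snd q) (snd p)\<bar> \<le> int K"
      by (auto simp: R_def intro: K(5))
    with True show ?thesis
      by (simp add: m_def)
  qed (simp add: m_def)
  have A: "Lop S x = (\<lambda>b. \<Sum>a\<in>R b. m b a * x a)" for x
    unfolding Lop_eq R_def[symmetric] by (intro ext sum.cong) (auto simp: m_def)
  have R: "finite (R p)" "card (R p) \<le> K" for p
    using K(1,2)[of "snd p"] by (auto simp: R_def intro: card_image_le[THEN order_trans])
  have col: "{p. q \<in> R p} = Pair (fst q + 1) ` {b. snd q \<in> chrow S b}" for q
    by (auto simp: R_def image_iff prod_eq_iff)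
  have R': "finite {p. q \<in> R p}" "card {p. q \<in> R p} \<le> K" for q
    unfolding col using K(3,4)[of "snd q"] by (auto intro: card_image_le[THEN order_trans])
  have off: "R p = {}" if "p \<notin> UNIV \<times> Eoff S" for p
    using that by (cases p) (simp add: R_def chrow_def)
  have "l2_operator (UNIV \<times> Eoff S) (Lop S) ((real K)\<^sup>2)"
  proof
    fix x :: "int \<times> 'e epath \<times> 'e \<Rightarrow> complex" assume x: "x \<in> l2 (UNIV \<times> Eoff S)"
    show "Lop S x \<in> l2 (UNIV \<times> Eoff S)"
      unfolding A by (rule sparse_l2[OF R R' m x off])
    show "nrm (Lop S x) \<le> (real K)\<^sup>2 * nrm x"
      unfolding A by (rule nrm_sparse_le[OF R R' m x off])
  qed (simp_all add: Lop_eq distrib_left distrib_right sum.distrib sum_distrib_left mult_ac)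
  then show ?thesis
    by blast
qed

text \<open>The entries of the matrix are integers, hence real.\<close>

lemma Aop_repart: "Aop S (repart x) = repart (Aop S x)"
proof -
  have "complex_of_int n * complex_of_real (Re z) = complex_of_real (Re (complex_of_int n * z))" for n z
    by (simp add: complex_eq_iff)
  then show ?thesis
    unfolding Aop_eq repart_def by (simp add: Re_sum)
qed

section \<open>The operator on chains of paths\<close>

lemma Aop_delta:
  assumes "a \<in> Eoff S"
  shows "Aop S (\<lambda>c. if c = a then 1 else 0) = (\<lambda>b. if b \<in> Eoff S then of_int (chmap S a b) else 0)"
proof
  fix b
  have "(\<Sum>c\<in>chrow S b. of_int (chmap S c b) * (if c = a then 1 else 0))
      = (if a \<in> chrow S b then of_int (chmap S a b) else 0 :: complex)"
    using finite_chrow[of b] by (simp add: if_distrib sum.delta cong: if_cong)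
  then show "Aop S (\<lambda>c. if c = a then 1 else 0) b = (if b \<in> Eoff S then of_int (chmap S a b) else 0)"
    using assms by (auto simp: Aop_eq chrow_def)
qed

text \<open>This is where invariance of \<open>H\<close> enters: an edge of \<open>H\<close> is
  killed by the projection, and its image, staying in \<open>H\<close>, is killed as well. For the
  other edges the equation reads off a column of the matrix.\<close>

lemma Aop_projchain_edge:
  assumes "reduced_path q" "gpath S (gbase S) q (gsrc S e)" "e \<in> gE S"
  shows "Aop S (projchain S q [(e, True)]) = projchain S (ftil S q) (gfE S e)"
proof (cases "e \<in> gHE S")
  case True
  then have "(q, e) \<notin> Eoff S"
    by (simp add: Eoff_iff)
  then have "projchain S q [(e, True)] = (\<lambda>_. 0)"
    by (auto simp: projchain_def liftchain_Cons)
  moreover have "projchain S (ftil S q) (gfE S e) b = 0" for b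
  proof (rule ccontr)
    assume "projchain S (ftil S q) (gfE S e) b \<noteq> 0"
    then have b: "b \<in> Eoff S" "liftchain (ftil S q) (gfE S e) b \<noteq> 0"
      by (auto simp: projchain_def split: if_splits)
    then have "snd b \<in> gHE S"
      using liftchain_nonzeroD[OF reduced_ftil b(2)] invariant True by (auto simp: invariant_subgraph_def)
    with b(1) show False
      by (cases b) (simp add: Eoff_iff)
  qed
  then have "projchain S (ftil S q) (gfE S e) = (\<lambda>_. 0)"
    by blast
  moreover have "Aop S (\<lambda>_. 0) = (\<lambda>_. 0)"
    by (simp add: Aop_eq)
  ultimately show ?thesis
    by simp
next
  case False
  with assms have qe: "(q, e) \<in> Eoff S"
    by (simp add: Eoff_iff)
  then have "projchain S q [(e, True)] = (\<lambda>c. if c = (q, e) then 1 else 0)"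
    by (auto simp: projchain_def liftchain_Cons)
  then show ?thesis
    by (simp only: Aop_delta[OF qe]) (auto simp: projchain_def chmap_def)
qed

lemma Aop_projchain_step:
  assumes "reduced_path q" "gpath S (gbase S) q a" "gpath S a [x] c"
  shows "Aop S (projchain S q [x]) = projchain S (ftil S q) (fpath S [x])"
proof -
  obtain e d where x: "x = (e, d)"
    by fastforce
  show ?thesis
  proof (cases d)
    case True
    then show ?thesis
      using Aop_projchain_edge[OF assms(1), of e] assms by (simp add: x fpath_Cons)
  next
    case False
    \<comment> \<open>A backward step from \<open>q\<close> is the inverse of the forward step along
      the same edge from \<open>q'\<close>, to which the previous lemma applies.\<close>
    define q' where "q' = reduce (q @ [x])"
    have x_pinv: "[x] = pinv [(e, True)]"
      by (simp add: x False pinv_Cons linv_Pair)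
    have "gpath S (gbase S) q' c" "c = gsrc S e" "e \<in> gE S"
      using assms False unfolding q'_def by (auto intro!: gpath_reduce simp: gpath_append x)
    then have edge: "Aop S (projchain S q' [(e, True)]) = projchain S (ftil S q') (gfE S e)"
      by (intro Aop_projchain_edge) (auto simp: q'_def)
    have "fpath S [x] = pinv (gfE S e)"
      by (simp add: x False fpath_Cons)
    moreover have "ftil S q' = reduce (ftil S q @ pinv (gfE S e))"
      unfolding q'_def ftil_append by (simp add: calculation)
    moreover have "projchain S q [x] = (\<lambda>a. -1 * projchain S q' [(e, True)] a)"
      unfolding x_pinv using projchain_pinv[OF assms(1)] by (simp add: q'_def x_pinv)
    moreover have "Aop S (\<lambda>a. -1 * projchain S q' [(e, True)] a) = (\<lambda>a. -1 * Aop S (projchain S q' [(e, True)]) a)"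
      unfolding Aop_eq by (simp add: sum_negf)
    ultimately show ?thesis
      using projchain_pinv[OF reduced_ftil, of S S q "gfE S e"] edge by simp
  qed
qed

text \<open>The chain map follows paths: the equation is proved step by step along \<open>s\<close>,
  with the unreduced image path on the right. Reducing that path later does not change its
  chain.\<close>

lemma Aop_projchain:
  assumes "reduced_path q" "gpath S (gbase S) q a" "gpath S a s b"
  shows "Aop S (projchain S q s) = projchain S (ftil S q) (fpath S s)"
  using assms
proof (induction s arbitrary: q a)
  case Nil
  then show ?case
    by (simp add: projchain_Nil Aop_eq)
next
  case (Cons x s)
  let ?q = "reduce (q @ [x])"
  obtain c where c: "gpath S a [x] c" "gpath S c s b"
    using Cons.prems(3) gpath_append[of a "[x]" s b] by auto
  have q: "gpath S (gbase S) ?q c"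
    using Cons.prems c by (auto intro!: gpath_reduce simp: gpath_append)
  have "Aop S (projchain S q (x # s)) = Aop S (\<lambda>a. projchain S q [x] a + projchain S ?q s a)"
    using projchain_append[OF Cons.prems(1), of S "[x]" s] by simp
  also have "\<dots> = (\<lambda>a. Aop S (projchain S q [x]) a + Aop S (projchain S ?q s) a)"
    by (simp add: Aop_eq distrib_left sum.distrib)
  also have "\<dots> = (\<lambda>a. projchain S (ftil S q) (fpath S [x]) a + projchain S (ftil S ?q) (fpath S s) a)"
    using Aop_projchain_step[OF Cons.prems(1,2) c(1)] Cons.IH[OF _ q c(2)] by simp
  also have "\<dots> = projchain S (ftil S q) (fpath S [x] @ fpath S s)"
    by (simp add: projchain_append ftil_append)
  also have "fpath S [x] @ fpath S s = fpath S (x # s)"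
    using fpath_append[of S "[x]" s] by simp
  finally show ?case .
qed

section \<open>Translates of Nielsen chains and their orbits\<close>

lemma deck_Eoff_iff:
  assumes "gpath S (gbase S) g (gbase S)" "reduced_path p"
  shows "(reduce (g @ p), e) \<in> Eoff S \<longleftrightarrow> (p, e) \<in> Eoff S"
proof -
  have "gpath S (gbase S) (reduce (g @ p)) b \<longleftrightarrow> gpath S (gbase S) p b" for b
  proof
    assume "gpath S (gbase S) (reduce (g @ p)) b"
    from gpath_deck[OF gpath_pinv[OF assms(1)] this] show "gpath S (gbase S) p b"
      using assms(2) by (simp add: reduce_reduced)
  qed (rule gpath_deck[OF assms(1)])
  then show ?thesis
    using assms(2) by (simp add: Eoff_iff)
qed

text \<open>Turns a translate of a chain, in the form in which \<open>nielsen\<close> presents it,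
  into the chain of a translated path, to which \<open>Aop_projchain\<close> applies.\<close>

lemma emb_gact_chain:
  assumes g: "g \<in> pi1 S" and u: "reduced_path u"
  shows "emb (gact S g (\<lambda>a. if a \<in> Eoff S then of_int (liftchain u r a) else 0))
    = projchain S (reduce (g @ u)) r"
proof
  fix a :: "'e epath \<times> 'e"
  obtain p e where a: "a = (p, e)"
    by fastforce
  show "emb (gact S g (\<lambda>a. if a \<in> Eoff S then of_int (liftchain u r a) else 0)) a
    = projchain S (reduce (g @ u)) r a"
  proof (cases "a \<in> cedges S")
    case True
    then have p: "reduced_path p"
      by (auto simp: a cedges_def cverts_def)
    have "(reduce (pinv g @ p), e) \<in> Eoff S \<longleftrightarrow> a \<in> Eoff S"
      using deck_Eoff_iff[OF gpath_pinv[OF pi1_loop[OF g]] p] by (simp add: a)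
    moreover have "liftchain (reduce (g @ u)) r (p, e) = liftchain u r (reduce (pinv g @ p), e)"
      using liftchain_deck[OF u, of "reduce (pinv g @ p)" g r e] p by (simp add: reduce_reduced)
    ultimately show ?thesis
      using True by (simp add: emb_def gact_def deck_def projchain_def a)
  next
    case False
    then show ?thesis
      by (simp add: emb_def gact_def projchain_def Eoff_def)
  qed
qed

lemma Phi_funpow_pi1: "g \<in> pi1 S \<Longrightarrow> (Phi S ^^ k) g \<in> pi1 S"
  by (induction k) (auto intro: Phi_pi1)

text \<open>Supplies the preimages required by bounded orbits: every translate is the image of
  another translate under any power of the operator.\<close>

lemma Phi_funpow_surj: "g \<in> pi1 S \<Longrightarrow> \<exists>h\<in>pi1 S. (Phi S ^^ k) h = g"
proof (induction k arbitrary: g)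
  case (Suc k)
  then have "g \<in> Phi S ` pi1 S"
    using equiv by (simp add: homotopy_equiv_def bij_betw_def)
  then obtain g' where "g' \<in> pi1 S" "Phi S g' = g"
    by blast
  with Suc.IH[of g'] show ?case
    by auto
qed auto

text \<open>As both endpoints are fixed, the path \<open>r\<close> between them is its own image up
  to reduction. The operator therefore takes the translate by \<open>h\<close> to the translate by
  \<open>Phi S h\<close>, so iterates and preimages are again translates and obey one common norm
  bound.\<close>

lemma fixed_chain_bounded_orbit:
  assumes "u \<in> cverts S" "v \<in> cverts S" "ftil S u = u" "ftil S v = v" and g: "g \<in> pi1 S"
    and op: "l2_operator (Eoff S) (Aop S) B"
  defines "r \<equiv> reduce (pinv u @ v)"
  shows "l2_operator.bounded_orbit (Eoff S) (Aop S) (real (length r * length r))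
    (projchain S (reduce (g @ u)) r)"
proof -
  obtain a b where ab: "gpath S (gbase S) u a" "gpath S (gbase S) v b"
    using assms by (auto simp: cverts_def)
  then have r: "gpath S a r b"
    unfolding r_def using gpath_pinv by (intro gpath_reduce) (auto simp: gpath_append)
  have u: "u = reduce (glift S @ fpath S u)" and v: "v = reduce (glift S @ fpath S v)"
    using assms by (simp_all add: ftil_def)
  \<comment> \<open>Both vertices are replaced by their images; the two copies of
    \<open>glift S\<close> then meet and cancel, leaving the image of \<open>r\<close>.\<close>
  have "r = reduce (pinv (reduce (glift S @ fpath S u)) @ reduce (glift S @ fpath S v))"
    using u v by (simp add: r_def)
  also have "\<dots> = reduce (fpath S r)"
    by (simp add: r_def pinv_append fpath_append fpath_pinv)
  finally have fr: "reduce (fpath S r) = r" ..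
  have step: "Aop S (projchain S (reduce (h @ u)) r) = projchain S (reduce (Phi S h @ u)) r"
    if "h \<in> pi1 S" for h
  proof -
    have "Aop S (projchain S (reduce (h @ u)) r) = projchain S (ftil S (reduce (h @ u))) (fpath S r)"
      using that by (intro Aop_projchain[OF _ _ r] gpath_deck ab pi1_loop) auto
    also have "\<dots> = projchain S (reduce (Phi S h @ u)) (reduce (fpath S r))"
      by (simp add: ftil_deck assms(3) projchain_reduce del: reduce_fpath_reduce_simps)
    finally show ?thesis
      by (simp add: fr)
  qed
  have pow: "(Aop S ^^ k) (projchain S (reduce (h @ u)) r) = projchain S (reduce ((Phi S ^^ k) h @ u)) r"
    if "h \<in> pi1 S" for h k
    using that by (induction k) (auto simp: step Phi_funpow_pi1)
  show ?thesis
    unfolding l2_operator.bounded_orbit_def[OF op]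
  proof (intro conjI allI l2_projchain)
    fix k
    show "nrm ((Aop S ^^ k) (projchain S (reduce (g @ u)) r)) \<le> real (length r * length r)"
      unfolding pow[OF g] by (rule nrm_projchain_le)
    obtain h where h: "h \<in> pi1 S" "(Phi S ^^ k) h = g"
      using Phi_funpow_surj[OF g] by blast
    show "\<exists>z\<in>l2 (Eoff S). nrm z \<le> real (length r * length r)
        \<and> (Aop S ^^ k) z = projchain S (reduce (g @ u)) r"
      using pow[OF h(1), of k] h(2)
      by (intro bexI[of _ "projchain S (reduce (h @ u)) r"] conjI nrm_projchain_le l2_projchain) simp
  qed
qed

lemma quasi_fixed_bounded_orbit:
  assumes flare: "chain_flare S Vh Vqf" and x: "x \<in> Vqf"
    and op: "l2_operator (Eoff S) (Aop S) B"
  shows "\<exists>c. l2_operator.bounded_orbit (Eoff S) (Aop S) c (emb x)"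
proof (cases "Vqf = {\<lambda>_. 0}")
  case True
  then show ?thesis
    using x l2_operator.bounded_orbit_zero[OF op] by (auto simp: emb_def)
next
  case False
  then obtain \<rho> where \<rho>: "nielsen S \<rho>"
    "\<forall>x\<in>Vqf. \<exists>(n::nat) q g. (\<forall>j<n. g j \<in> pi1 S) \<and> x = (\<lambda>a. \<Sum>j<n. q j * gact S (g j) \<rho> a)"
    using flare by (auto simp: chain_flare_def)
  obtain u v where uv: "u \<in> cverts S" "v \<in> cverts S" "ftil S u = u" "ftil S v = v"
    "\<rho> = (\<lambda>a. if a \<in> Eoff S then of_int (liftchain u (reduce (pinv u @ v)) a) else 0)"
    using \<rho>(1) by (auto simp: nielsen_def)
  have u: "reduced_path u"
    using uv by (simp add: cverts_def)
  obtain n :: nat and q g where x': "\<forall>j<n. g j \<in> pi1 S" "x = (\<lambda>a. \<Sum>j<n. q j * gact S (g j) \<rho> a)"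
    using \<rho>(2) x by blast
  have one: "\<exists>c. l2_operator.bounded_orbit (Eoff S) (Aop S) c (emb (gact S h \<rho>))" if "h \<in> pi1 S" for h
    unfolding uv(5) emb_gact_chain[OF that u]
    using fixed_chain_bounded_orbit[OF uv(1-4) that op] by blast
  have "\<exists>c. l2_operator.bounded_orbit (Eoff S) (Aop S) c (emb (\<lambda>a. \<Sum>j<n. q j * gact S (g j) \<rho> a))"
    using x'(1)
  proof (induction n)
    case 0
    then show ?case
      using l2_operator.bounded_orbit_zero[OF op] by (auto simp: emb_def)
  next
    case (Suc n)
    obtain c d where c: "l2_operator.bounded_orbit (Eoff S) (Aop S) c (emb (\<lambda>a. \<Sum>j<n. q j * gact S (g j) \<rho> a))"
      and d: "l2_operator.bounded_orbit (Eoff S) (Aop S) d (emb (gact S (g n) \<rho>))"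
      using Suc one[of "g n"] by auto
    have "emb (\<lambda>a. \<Sum>j<Suc n. q j * gact S (g j) \<rho> a)
      = (\<lambda>a. emb (\<lambda>a. \<Sum>j<n. q j * gact S (g j) \<rho> a) a + of_rat (q n) * emb (gact S (g n) \<rho>) a)"
      by (simp add: emb_def of_rat_add of_rat_mult)
    then show ?case
      using l2_operator.bounded_orbit_add[OF op c l2_operator.bounded_orbit_scale[OF op d, of "of_rat (q n)"]]
      by (simp only:) (rule exI)
  qed
  then show ?thesis
    by (simp add: x'(2))
qed

end

section \<open>Quasi-fixed chains and slow vectors\<close>

lemma rational_approx:
  assumes x: "x \<in> l2 D" "repart x = x" and "\<epsilon> > 0"
  obtains z :: "'a \<Rightarrow> rat" where "finite {a. z a \<noteq> 0}" "\<forall>a. a \<notin> D \<longrightarrow> z a = 0"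
    "nrm (\<lambda>a. emb z a - x a) < \<epsilon>"
proof -
  obtain F where F: "finite F" "F \<subseteq> D" "nrm (\<lambda>a. if a \<in> F then 0 else x a) < \<epsilon> / 2"
    using l2_tail[OF x(1), of "\<epsilon> / 2"] assms(3) by auto
  \<comment> \<open>Rounding errors of size \<eta> at the points of \<open>F\<close> add up to at
    most half of \<epsilon>; the summand 1 keeps the denominator positive when \<open>F\<close> is
    empty.\<close>
  define \<eta> where "\<eta> = \<epsilon> / (2 * (real (card F) + 1))"
  have \<eta>: "\<eta> > 0" "real (card F) * \<eta> \<le> \<epsilon> / 2"
    using assms(3) by (auto simp: \<eta>_def field_simps)
  have "\<exists>q. \<bar>of_rat q - Re (x a)\<bar> < \<eta>" for a
  proof -
    obtain q where "Re (x a) < of_rat q" "of_rat q < Re (x a) + \<eta>"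
      using of_rat_dense[of "Re (x a)" "Re (x a) + \<eta>"] \<eta> by auto
    then show ?thesis
      by (intro exI[of _ q]) auto
  qed
  then obtain q where q: "\<And>a. \<bar>of_rat (q a) - Re (x a)\<bar> < \<eta>"
    by metis
  define z where "z a = (if a \<in> F then q a else 0)" for a
  define u where "u a = (if a \<in> F then emb z a - x a else 0)" for a
  have u: "cmod (u a) \<le> \<eta>" for a
  proof (cases "a \<in> F")
    case True
    have xa: "x a = complex_of_real (Re (x a))"
      using fun_cong[OF x(2), of a] by (simp add: repart_def)
    have "of_rat (q a) = complex_of_real (of_rat (q a))"
      by (cases "q a") (simp add: of_rat_rat)
    then have "u a = complex_of_real (of_rat (q a) - Re (x a))"
      using True xa by (simp add: u_def z_def emb_def)
    then show ?thesis
      using q[of a] by (simp only: norm_of_real)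
  qed (use \<eta> in \<open>simp add: u_def\<close>)
  have le: "L2_set (\<lambda>a. cmod (u a)) G \<le> real (card F) * \<eta>" if G: "finite G" for G
  proof -
    have "L2_set (\<lambda>a. cmod (u a)) G \<le> (\<Sum>a\<in>G. cmod (u a))"
      by (rule L2_set_le_sum) auto
    also have "\<dots> = (\<Sum>a\<in>G \<inter> F. cmod (u a))"
      using G by (intro sum.mono_neutral_right) (auto simp: u_def)
    also have "\<dots> \<le> (\<Sum>a\<in>F. cmod (u a))"
      using F by (intro sum_mono2) auto
    also have "\<dots> \<le> (\<Sum>a\<in>F. \<eta>)"
      by (intro sum_mono u)
    finally show ?thesis
      by simp
  qed
  have off: "u a = 0" if "a \<notin> D" for a
    using that F by (auto simp: u_def)
  have tail: "(\<lambda>a. if a \<in> F then 0 else x a) \<in> l2 D"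
    using x(1) by (rule l2_dominated) (use l2_zero_off[OF x(1)] in auto)
  have "(\<lambda>a. emb z a - x a) = (\<lambda>a. u a - (if a \<in> F then 0 else x a))"
    by (auto simp: u_def z_def emb_def)
  then have "nrm (\<lambda>a. emb z a - x a) \<le> nrm u + nrm (\<lambda>a. if a \<in> F then 0 else x a)"
    using nrm_diff_triangle[OF l2_nrm_boundI(1)[OF off le] l2_zero tail]
      nrm_scale[of "-1" "\<lambda>a. if a \<in> F then 0 else x a"] by simp
  also have "\<dots> < \<epsilon>"
    using F(3) \<eta>(2) l2_nrm_boundI(2)[where D = D, OF off le] by simp
  finally have "nrm (\<lambda>a. emb z a - x a) < \<epsilon>" .
  moreover have "finite {a. z a \<noteq> 0}"
    using F by (auto simp: z_def intro: finite_subset)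
  moreover have "z a = 0" if "a \<notin> D" for a
    using that F by (auto simp: z_def)
  ultimately show thesis
    using that by blast
qed

lemma emb_l2: "z \<in> rchains S \<Longrightarrow> emb z \<in> l2 (Eoff S)"
  by (intro l2_finite_support) (auto simp: rchains_def emb_def)

context graph_map
begin

section \<open>Reduction to single levels and membership of slow vectors\<close>

lemma Lop_funpow_slice: "(\<lambda>b. (Lop S ^^ j) x (l, b)) = (Aop S ^^ j) (\<lambda>a. x (l - int j, a))"
proof (induction j arbitrary: l)
  case (Suc j)
  have "(\<lambda>b. (Lop S ^^ Suc j) x (l, b)) = Aop S (\<lambda>a. (Lop S ^^ j) x (l - 1, a))"
    by (simp add: Lop_def)
  also have "\<dots> = Aop S ((Aop S ^^ j) (\<lambda>a. x (l - 1 - int j, a)))"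
    by (simp add: Suc.IH)
  finally show ?case
    by (simp add: algebra_simps)
qed simp

lemma Lop_funpow_inject: "(Lop S ^^ j) (inject k x) = inject (k + int j) ((Aop S ^^ j) x)"
proof
  fix p :: "int \<times> 'e epath \<times> 'e"
  obtain l b where p: "p = (l, b)"
    by (cases p)
  have A0: "Aop S (\<lambda>_. 0) = (\<lambda>_. 0)"
    by (simp add: Aop_eq)
  then have zero: "(Aop S ^^ j) (\<lambda>_. 0) = (\<lambda>_. 0)"
    by (induction j) auto
  show "(Lop S ^^ j) (inject k x) p = inject (k + int j) ((Aop S ^^ j) x) p"
  proof (cases "l = k + int j")
    case True
    then have "(\<lambda>a. inject k x (l - int j, a)) = x"
      by (simp add: inject_def)
    then show ?thesis
      using fun_cong[OF Lop_funpow_slice[of j "inject k x" l], of b] True by (simp add: p inject_def)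
  next
    case False
    then have "(\<lambda>a. inject k x (l - int j, a)) = (\<lambda>_. 0)"
      by (auto simp: inject_def)
    then show ?thesis
      using fun_cong[OF Lop_funpow_slice[of j "inject k x" l], of b] False zero by (simp add: p inject_def)
  qed
qed

text \<open>Restricting to one level does not increase norms and commutes with iteration up to a
  shift of the level. The gap between \<nu> and \<mu> is what allows a limsup of roots to become a
  bound by powers.\<close>

lemma slow_slice:
  assumes op: "l2_operator (Eoff S) (Aop S) B" and op': "l2_operator (UNIV \<times> Eoff S) (Lop S) B'"
    and E: "\<xi> \<in> frakE (UNIV \<times> Eoff S) (Lop S) \<nu>"
    and F: "\<xi> \<in> frakF (UNIV \<times> Eoff S) (Lop S) (inverse \<nu>)" and \<mu>: "\<nu> < \<mu>"
  shows "l2_operator.slow (Eoff S) (Aop S) \<mu> (\<lambda>a. \<xi> (l, a))"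
proof -
  interpret L: l2_operator "UNIV \<times> Eoff S" "Lop S" B'
    by (rule op')
  have \<xi>: "\<xi> \<in> l2 (UNIV \<times> Eoff S)"
    using E by (simp add: frakE_def)
  obtain s where s: "\<And>j. s j \<in> l2 (UNIV \<times> Eoff S)" "(\<lambda>j. nrm (\<lambda>a. s j a - \<xi> a)) \<longlonglongrightarrow> 0"
    "limsup (\<lambda>j. ereal (root j (nrm ((Lop S ^^ j) (s j))))) \<le> ereal \<nu>"
    using E by (auto simp: frakE_def)
  obtain t where t: "\<And>j. t j \<in> l2 (UNIV \<times> Eoff S)"
    "(\<lambda>j. nrm (\<lambda>a. (Lop S ^^ j) (t j) a - \<xi> a)) \<longlonglongrightarrow> 0"
    "limsup (\<lambda>j. ereal (root j (nrm (t j)))) \<le> ereal \<nu>"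
    using F by (auto simp: frakF_def)
  have s_pow: "(Aop S ^^ j) (\<lambda>a. s j (l, a)) = (\<lambda>b. (Lop S ^^ j) (s j) (l + int j, b))" for j
    by (simp add: Lop_funpow_slice)
  show ?thesis
  \<comment> \<open>The vectors \<open>t j\<close> reach level \<open>l\<close> only after
    \<open>j\<close> shifts, so they are sliced at the moving level \<open>l - int j\<close>; the
    vectors \<open>s j\<close> start at level \<open>l\<close> itself.\<close>
  proof (rule l2_operator.slowI[OF op, where s = "\<lambda>j a. s j (l, a)" and C = 1
        and t = "\<lambda>j a. t j (l - int j, a)" and C' = 1])
    show "(\<lambda>a. \<xi> (l, a)) \<in> l2 (Eoff S)" "(\<lambda>a. s j (l, a)) \<in> l2 (Eoff S)"
      "(\<lambda>a. t j (l - int j, a)) \<in> l2 (Eoff S)" for j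
      using \<xi> s t by (auto intro: l2_slice)
    have "nrm (\<lambda>a. s j (l, a) - \<xi> (l, a)) \<le> nrm (\<lambda>a. s j a - \<xi> a)" for j
      by (rule nrm_slice_le[OF l2_diff[OF s(1) \<xi>]])
    then show "(\<lambda>j. nrm (\<lambda>a. s j (l, a) - \<xi> (l, a))) \<longlonglongrightarrow> 0"
      by (intro Lim_null_comparison[OF always_eventually s(2)]) simp
    have "nrm (\<lambda>a. (Lop S ^^ j) (t j) (l, a) - \<xi> (l, a)) \<le> nrm (\<lambda>a. (Lop S ^^ j) (t j) a - \<xi> a)" for j
      by (rule nrm_slice_le[OF l2_diff[OF L.pow_l2[OF t(1)] \<xi>]])
    then show "(\<lambda>j. nrm (\<lambda>a. (Aop S ^^ j) (\<lambda>a. t j (l - int j, a)) a - \<xi> (l, a))) \<longlonglongrightarrow> 0"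
      unfolding Lop_funpow_slice[symmetric] by (intro Lim_null_comparison[OF always_eventually t(2)]) simp
    have "\<forall>\<^sub>F j in sequentially. nrm ((Lop S ^^ j) (s j)) \<le> \<mu> ^ j"
      by (rule eventually_le_power_of_limsup_root[OF s(3) \<mu>]) simp
    then show "\<forall>\<^sub>F j in sequentially. nrm ((Aop S ^^ j) (\<lambda>a. s j (l, a))) \<le> 1 * \<mu> ^ j"
      unfolding s_pow by eventually_elim (simp add: order_trans[OF nrm_slice_le[OF L.pow_l2[OF s(1)]]])
    have "\<forall>\<^sub>F j in sequentially. nrm (t j) \<le> \<mu> ^ j"
      by (rule eventually_le_power_of_limsup_root[OF t(3) \<mu>]) simp
    then show "\<forall>\<^sub>F j in sequentially. nrm (\<lambda>a. t j (l - int j, a)) \<le> 1 * \<mu> ^ j"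
      by eventually_elim (simp add: order_trans[OF nrm_slice_le[OF t(1)]])
  qed
qed

lemma emb_Vqf_l2:
  assumes "chain_flare S Vh Vqf"
  shows "emb ` Vqf \<subseteq> l2 (Eoff S)"
  using assms emb_l2 by (auto simp: chain_flare_def qmodule_def)

text \<open>The distance of \<^term>\<open>x\<close> to the quasi-fixed chains is positive, so after subtracting a
suitable one of them it becomes arbitrarily close, in angle, to a chain in \<^term>\<open>Vh\<close>.\<close>

lemma real_slow_in_Vqf2:
  assumes op: "l2_operator (Eoff S) (Aop S) B" and flare: "chain_flare S Vh Vqf"
    and lam: "1 < lam" "0 < \<theta>" "\<theta> < 1"
      "\<forall>x \<in> Ninf S (Ntheta S \<theta> Vh). lam * nrm (Aop S x) \<le> max (nrm (Aop S (Aop S x))) (nrm x)"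
    and \<mu>: "1 \<le> \<mu>" "\<mu> < lam"
    and x: "l2_operator.slow (Eoff S) (Aop S) \<mu> x" "repart x = x"
  shows "x \<in> Vqf2 S Vqf"
proof (rule ccontr)
  interpret A: l2_operator "Eoff S" "Aop S" B
    by (rule op)
  assume "x \<notin> Vqf2 S Vqf"
  moreover have x2: "x \<in> l2 (Eoff S)"
    using x by (auto intro: A.slow_l2)
  ultimately obtain d where "d > 0" "\<not> (\<exists>s\<in>cxspan (emb ` Vqf). nrm (\<lambda>a. s a - x a) < d)"
    unfolding Vqf2_def lclosure_iff by blast
  then have d: "d > 0" "\<And>s. s \<in> cxspan (emb ` Vqf) \<Longrightarrow> d \<le> nrm (\<lambda>a. s a - x a)"
    by (simp, meson not_le)
  \<comment> \<open>The relative radius that \<open>cinner_gt_of_close\<close> allows around a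
    vector of \<open>Vh\<close>.\<close>
  define c where "c = (1 - \<theta>) / 2"
  have c: "0 < c" "c < 1 / 2"
    using lam by (auto simp: c_def)
  \<comment> \<open>With this accuracy the hyperbolic part \<open>v\<close> keeps norm at least
    \<open>d / 2\<close>, because \<open>y\<close> below has norm at least \<open>d\<close> and
    differs from \<open>v\<close> by less than \<open>d / 4\<close>. Hence the error is also small
    relative to \<open>v\<close>.\<close>
  have "c / 2 * d > 0"
    using c d by simp
  with x2 x(2) obtain z :: "'e epath \<times> 'e \<Rightarrow> rat" where
    z: "finite {a. z a \<noteq> 0}" "\<forall>a. a \<notin> Eoff S \<longrightarrow> z a = 0" and zx: "nrm (\<lambda>a. emb z a - x a) < c / 2 * d"
    by (rule rational_approx)
  have "z \<in> rchains S"
    using z by (simp add: rchains_def)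
  then have "z \<in> {(\<lambda>a. x a + y a) | x y. x \<in> Vh \<and> y \<in> Vqf}"
    using flare by (simp add: chain_flare_def)
  then obtain v w where vw: "v \<in> Vh" "w \<in> Vqf" "z = (\<lambda>a. v a + w a)"
    by blast
  \<comment> \<open>Removing the quasi-fixed part \<open>w\<close> keeps the vector slow, and its
    difference from \<open>emb v\<close> is, up to sign, the approximation error of
    \<open>emb z\<close>.\<close>
  define y where "y = (\<lambda>a. x a + -1 * emb w a)"
  obtain k where k: "A.bounded_orbit k (emb w)"
    using quasi_fixed_bounded_orbit[OF flare vw(2) op] by blast
  have y: "A.slow \<mu> y"
    unfolding y_def using \<mu> by (intro A.slow_add[OF x(1)] A.slow_scale A.slow_bounded_orbit[OF k])
  have v2: "emb v \<in> l2 (Eoff S)" and y2: "y \<in> l2 (Eoff S)"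
    using flare vw y by (auto simp: chain_flare_def qmodule_def intro: emb_l2 A.slow_l2)
  have "emb w \<in> cxspan (emb ` Vqf)"
    using vw by (intro cxspan_base) auto
  from d(2)[OF this] have dy: "d \<le> nrm y"
    unfolding nrm_diff_commute[of "emb w"] by (simp add: y_def)
  have "nrm (\<lambda>a. y a - emb v a) = nrm (\<lambda>a. emb z a - x a)"
    unfolding nrm_diff_commute[of "emb z"] by (simp add: y_def emb_def vw(3) of_rat_add algebra_simps)
  then have yv: "nrm (\<lambda>a. y a - emb v a) < c / 2 * d"
    using zx by simp
  have close: "nrm (\<lambda>a. y a - emb v a) < c * nrm (emb v)"
  proof -
    have "nrm y \<le> nrm (\<lambda>a. y a - emb v a) + nrm (emb v)"
      by (rule nrm_le_diff[OF y2 v2])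
    moreover have "c / 2 * d \<le> 1 / 4 * d"
      using c d by (intro mult_right_mono) auto
    ultimately have "1 / 2 * d \<le> nrm (emb v)"
      using dy yv d(1) by linarith
    then have "c * (1 / 2 * d) \<le> c * nrm (emb v)"
      using c by (intro mult_left_mono) auto
    with yv show ?thesis
      by simp
  qed
  \<comment> \<open>The margin left inside the admissible ball around \<open>emb v\<close>; a whole
    neighbourhood of \<open>y\<close> thus lies in the cone.\<close>
  define \<delta> where "\<delta> = c * nrm (emb v) - nrm (\<lambda>a. y a - emb v a)"
  have near: "u \<in> Ntheta S \<theta> Vh" if u: "u \<in> l2 (Eoff S)" "nrm (\<lambda>a. u a - y a) < \<delta>" for u
  proof -
    have "nrm (\<lambda>a. u a - emb v a) < c * nrm (emb v)"
      using nrm_diff_triangle[OF u(1) y2 v2] u(2) by (simp add: \<delta>_def)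
    then have "Re (cinner (emb v) u) > \<theta> * nrm (emb v) * nrm u"
      using cinner_gt_of_close[OF v2 u(1) lam(2,3)] by (simp add: c_def)
    with u vw show ?thesis
      by (auto simp: Ntheta_def)
  qed
  show False
  proof (rule A.slow_not_flaring[OF y \<mu>])
    show "nrm y \<noteq> 0"
      using dy d by simp
    show "0 < \<delta>"
      using close by (simp add: \<delta>_def)
    show "u \<in> Ntheta S \<theta> Vh" if "u \<in> l2 (Eoff S)" "nrm (\<lambda>a. u a - y a) < \<delta>" for u
      using that by (rule near)
    show "lam * nrm (Aop S u) \<le> max (nrm (Aop S (Aop S u))) (nrm u)"
      if "u \<in> l2 (Eoff S)" "(\<exists>z\<in>Ntheta S \<theta> Vh. \<exists>k. u = (Aop S ^^ k) z) \<or> (\<exists>k. (Aop S ^^ k) u \<in> Ntheta S \<theta> Vh)"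
      for u
      using lam(4) that by (auto simp: Ninf_def)
  qed
qed

text \<open>The imaginary part of \<open>x\<close> is the real part of \<open>- \<i> * x\<close>.
  Both parts are slow because the operator commutes with \<open>repart\<close>, and the complex
  closed span contains their recombination.\<close>

lemma slow_in_Vqf2:
  assumes op: "l2_operator (Eoff S) (Aop S) B" and flare: "chain_flare S Vh Vqf"
    and lam: "1 < lam" "0 < \<theta>" "\<theta> < 1"
      "\<forall>x \<in> Ninf S (Ntheta S \<theta> Vh). lam * nrm (Aop S x) \<le> max (nrm (Aop S (Aop S x))) (nrm x)"
    and \<mu>: "1 \<le> \<mu>" "\<mu> < lam"
    and x: "l2_operator.slow (Eoff S) (Aop S) \<mu> x"
  shows "x \<in> Vqf2 S Vqf"
proof -
  interpret A: l2_operator "Eoff S" "Aop S" B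
    by (rule op)
  have "A.slow \<mu> (repart x)" "A.slow \<mu> (repart (\<lambda>a. - \<i> * x a))"
    by (intro A.slow_repart Aop_repart A.slow_scale x)+
  then have in_V: "repart x \<in> Vqf2 S Vqf" "repart (\<lambda>a. - \<i> * x a) \<in> Vqf2 S Vqf"
    using real_slow_in_Vqf2[OF op flare lam \<mu>] by (auto simp: repart_def)
  have "(\<lambda>a. repart x a + \<i> * repart (\<lambda>a. - \<i> * x a) a) \<in> Vqf2 S Vqf"
    using in_V unfolding Vqf2_def
    by (intro lclosure_add[OF cxspan_l2[OF emb_Vqf_l2[OF flare]] cxspan_add] lclosure_scale[OF cxspan_scale])
  also have "(\<lambda>a. repart x a + \<i> * repart (\<lambda>a. - \<i> * x a) a) = x"
    by (auto simp: repart_def complex_eq_iff)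
  finally show ?thesis .
qed

text \<open>The property is passed on in stages: from quasi-fixed chains to their complex span, from
  there to single levels, to limits, to finite sums over levels and to limits again. The last
  closure is absorbed by \<open>lclosure_closed\<close>.\<close>

lemma Wqf_bounded_orbits:
  assumes op: "l2_operator (Eoff S) (Aop S) B" and op': "l2_operator (UNIV \<times> Eoff S) (Lop S) B'"
    and flare: "chain_flare S Vh Vqf"
  shows "Wqf S Vqf \<subseteq> lclosure (UNIV \<times> Eoff S)
    {s. \<exists>c. l2_operator.bounded_orbit (UNIV \<times> Eoff S) (Lop S) c s}"
proof -
  interpret A: l2_operator "Eoff S" "Aop S" B
    by (rule op)
  interpret L: l2_operator "UNIV \<times> Eoff S" "Lop S" B'
    by (rule op')
  let ?G = "{s. \<exists>c. L.bounded_orbit c s}"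
  have G: "?G \<subseteq> l2 (UNIV \<times> Eoff S)"
    by (auto intro: L.bounded_orbit_l2)
  have G_add: "(\<lambda>a. x a + y a) \<in> ?G" if "x \<in> ?G" "y \<in> ?G" for x y
    using that L.bounded_orbit_add by blast
  \<comment> \<open>Forward iterates of a copy at level \<open>k\<close> are copies at higher
    levels; its preimage under \<open>Lop S ^^ j\<close> is taken at level
    \<open>k - int j\<close>.\<close>
  have lift: "L.bounded_orbit c (inject k x)" if x: "A.bounded_orbit c x" for c k x
    unfolding L.bounded_orbit_def
  proof (intro conjI allI)
    have x2: "x \<in> l2 (Eoff S)"
      using x by (rule A.bounded_orbit_l2)
    then show "inject k x \<in> l2 (UNIV \<times> Eoff S)"
      by (rule l2_inject)
    fix j
    show "nrm ((Lop S ^^ j) (inject k x)) \<le> c"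
      using nrm_inject_le[OF A.pow_l2[OF x2, of j], of "k + int j"] x
      by (fastforce simp: Lop_funpow_inject A.bounded_orbit_def intro: order_trans)
    obtain z where "z \<in> l2 (Eoff S)" "nrm z \<le> c" "(Aop S ^^ j) z = x"
      using x unfolding A.bounded_orbit_def by blast
    then show "\<exists>z\<in>l2 (UNIV \<times> Eoff S). nrm z \<le> c \<and> (Lop S ^^ j) z = inject k x"
      by (intro bexI[of _ "inject (k - int j) z"])
        (auto simp: Lop_funpow_inject intro: l2_inject order_trans[OF nrm_inject_le])
  qed
  have span: "\<exists>c. A.bounded_orbit c w" if "w \<in> cxspan (emb ` Vqf)" for w
    using that
  proof (induction rule: cxspan_induct)
    case zero
    then show ?case
      using A.bounded_orbit_zero by blast
  next
    case (add q x y)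
    then obtain c d where "A.bounded_orbit c x" "A.bounded_orbit d y"
      using quasi_fixed_bounded_orbit[OF flare _ op] by blast
    then show ?case
      using A.bounded_orbit_add A.bounded_orbit_scale by blast
  qed
  have inj: "inject k v \<in> lclosure (UNIV \<times> Eoff S) ?G" if v: "v \<in> Vqf2 S Vqf" for k v
    unfolding lclosure_iff
  proof (intro conjI allI impI)
    have v2: "v \<in> l2 (Eoff S)"
      using v unfolding Vqf2_def by (rule lclosure_l2)
    then show "inject k v \<in> l2 (UNIV \<times> Eoff S)"
      by (rule l2_inject)
    fix \<epsilon> :: real assume "\<epsilon> > 0"
    then obtain w where w: "w \<in> cxspan (emb ` Vqf)" "nrm (\<lambda>a. w a - v a) < \<epsilon>"
      using v unfolding Vqf2_def lclosure_iff by blast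
    then have w2: "w \<in> l2 (Eoff S)"
      using cxspan_l2[OF emb_Vqf_l2[OF flare]] by blast
    have "(\<lambda>p. inject k w p - inject k v p) = inject k (\<lambda>a. w a - v a)"
      by (auto simp: inject_def)
    then have "nrm (\<lambda>p. inject k w p - inject k v p) < \<epsilon>"
      using nrm_inject_le[OF l2_diff[OF w2 v2], of k] w(2) by simp
    moreover have "inject k w \<in> ?G"
      using span[OF w(1)] lift by blast
    ultimately show "\<exists>s\<in>?G. nrm (\<lambda>p. s p - inject k v p) < \<epsilon>"
      by (rule bexI)
  qed
  have sums: "(\<lambda>(l, a). \<Sum>i<n. if l = k i then v i a else 0) \<in> lclosure (UNIV \<times> Eoff S) ?G"
    if "\<forall>i<n. v i \<in> Vqf2 S Vqf" for n :: nat and k v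
    using that
  proof (induction n)
    case 0
    have "(\<lambda>_. 0) \<in> ?G"
      using L.bounded_orbit_zero by blast
    then have "(\<lambda>_. 0) \<in> lclosure (UNIV \<times> Eoff S) ?G"
      using lclosure_superset[OF G] by blast
    then show ?case
      by (simp add: case_prod_beta')
  next
    case (Suc n)
    have "(\<lambda>(l, a). \<Sum>i<Suc n. if l = k i then v i a else 0)
      = (\<lambda>p. (case p of (l, a) \<Rightarrow> \<Sum>i<n. if l = k i then v i a else 0) + inject (k n) (v n) p)"
      by (auto simp: inject_def fun_eq_iff)
    also have "\<dots> \<in> lclosure (UNIV \<times> Eoff S) ?G"
      using Suc by (intro lclosure_add[OF G G_add] inj) auto
    finally show ?case .
  qed
  show ?thesis
    unfolding Wqf_def
    by (rule lclosure_closed[OF subsetI G]) (elim CollectE exE conjE, hypsubst, rule sums)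
qed

text \<open>All but \<epsilon> of the norm sits on a finite set \<open>F\<close>, which meets
  finitely many levels. Keeping the entire slices at these levels, and not merely the points of
  \<open>F\<close>, makes every summand an element of \<open>Vqf2\<close>.\<close>

lemma Wqf_of_slices:
  assumes \<xi>: "\<xi> \<in> l2 (UNIV \<times> Eoff S)" and slices: "\<And>l. (\<lambda>a. \<xi> (l, a)) \<in> Vqf2 S Vqf"
  shows "\<xi> \<in> Wqf S Vqf"
  unfolding Wqf_def lclosure_iff
proof (intro conjI allI impI \<xi>)
  fix \<epsilon> :: real assume "\<epsilon> > 0"
  obtain F where "finite F" "F \<subseteq> UNIV \<times> Eoff S" "nrm (\<lambda>p. if p \<in> F then 0 else \<xi> p) < \<epsilon>"
    using \<xi> \<open>\<epsilon> > 0\<close> by (rule l2_tail)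
  note F = this(1,3)
  have tail: "(\<lambda>p. if p \<in> F then 0 else \<xi> p) \<in> l2 UNIV"
    using \<xi> by (rule l2_dominated) auto
  obtain h :: "nat \<Rightarrow> int" and n where h: "bij_betw h {..<n} (fst ` F)"
    using ex_bij_betw_nat_finite[of "fst ` F"] F by (auto simp: lessThan_atLeast0)
  define s where "s = (\<lambda>(l, a). \<Sum>i<n. if l = h i then \<xi> (h i, a) else 0)"
  have s: "s (l, a) = (if l \<in> fst ` F then \<xi> (l, a) else 0)" for l a
  proof -
    have "s (l, a) = (\<Sum>k\<in>fst ` F. if l = k then \<xi> (k, a) else 0)"
      unfolding s_def using sum.reindex_bij_betw[OF h, of "\<lambda>k. if l = k then \<xi> (k, a) else 0"] by simp
    then show ?thesis
      using F by simp
  qed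
  \<comment> \<open>On the kept levels the difference is 0; on every other level \<open>s\<close>
    vanishes and the point lies outside \<open>F\<close>, so the two sides agree.\<close>
  have "cmod (s p - \<xi> p) \<le> cmod (if p \<in> F then 0 else \<xi> p)" for p
    using s[of "fst p" "snd p"] by (auto simp: image_iff)
  then have "nrm (\<lambda>p. s p - \<xi> p) \<le> nrm (\<lambda>p. if p \<in> F then 0 else \<xi> p)"
    by (intro l2_dominated(2)[OF tail, where D' = UNIV]) auto
  then have "nrm (\<lambda>p. s p - \<xi> p) < \<epsilon>"
    using F(2) by simp
  moreover have "s \<in> {\<lambda>(l, a). \<Sum>i<n. if l = k i then v i a else 0 |(n::nat) k v. \<forall>i<n. v i \<in> Vqf2 S Vqf}"
    unfolding s_def
    by (intro CollectI exI[of _ n] exI[of _ h] exI[of _ "\<lambda>i a. \<xi> (h i, a)"] conjI refl allI impI slices)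
  ultimately show "\<exists>s\<in>{\<lambda>(l, a). \<Sum>i<n. if l = k i then v i a else 0 |(n::nat) k v. \<forall>i<n. v i \<in> Vqf2 S Vqf}.
      nrm (\<lambda>p. s p - \<xi> p) < \<epsilon>"
    by (rule bexI)
qed

end

section \<open>The intersection of the two spectral spaces\<close>

theorem theorem7p4:
  fixes S :: "('v, 'e) gsetup"
    and Vh Vqf :: "('e epath \<times> 'e \<Rightarrow> rat) set"
  assumes "graph_ok S"
    and "subgraph_ok S"
    and "cellular_map S"
    and "homotopy_equiv S"
    and "invariant_subgraph S"
    and "lift_ok S"
    and "chain_flare S Vh Vqf"
  shows "\<exists>lam::real. lam > 1 \<and> (\<forall>\<nu>::real. 1 \<le> \<nu> \<and> \<nu> < lam \<longrightarrow>
           Wqf S Vqf = frakE (UNIV \<times> Eoff S) (Lop S) \<nu> \<inter> frakF (UNIV \<times> Eoff S) (Lop S) (inverse \<nu>))"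
proof -
  interpret graph_map S
    using assms by unfold_locales
  obtain B B' where op: "l2_operator (Eoff S) (Aop S) B"
    and op': "l2_operator (UNIV \<times> Eoff S) (Lop S) B'"
    using Aop_operator Lop_operator by blast
  note flare = assms(7)
  obtain lam \<theta> where lam: "1 < lam" "0 < \<theta>" "\<theta> < 1"
      "\<forall>x \<in> Ninf S (Ntheta S \<theta> Vh). lam * nrm (Aop S x) \<le> max (nrm (Aop S (Aop S x))) (nrm x)"
    using flare unfolding chain_flare_def by blast
  show ?thesis
  proof (intro exI[of _ lam] conjI allI impI equalityI subsetI)
    show "1 < lam"
      by (rule lam)
    fix \<nu> :: real and \<xi> assume \<nu>: "1 \<le> \<nu> \<and> \<nu> < lam"
    show "\<xi> \<in> frakE (UNIV \<times> Eoff S) (Lop S) \<nu> \<inter> frakF (UNIV \<times> Eoff S) (Lop S) (inverse \<nu>)"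
      if "\<xi> \<in> Wqf S Vqf"
      using that Wqf_bounded_orbits[OF op op' flare] \<nu>
        l2_operator.frakE_frakF_of_bounded_orbits[OF op', of \<xi> \<nu>] by blast
    assume \<xi>: "\<xi> \<in> frakE (UNIV \<times> Eoff S) (Lop S) \<nu> \<inter> frakF (UNIV \<times> Eoff S) (Lop S) (inverse \<nu>)"
    \<comment> \<open>The midpoint serves as \<mu>: above \<nu> so that the limsup conditions yield
      bounds by powers, and below \<open>lam\<close> so that flaring outruns them.\<close>
    have "\<nu> < (\<nu> + lam) / 2" "1 \<le> (\<nu> + lam) / 2" "(\<nu> + lam) / 2 < lam"
      using \<nu> by auto
    then have "(\<lambda>a. \<xi> (l, a)) \<in> Vqf2 S Vqf" for l
      using slow_in_Vqf2[OF op flare lam] slow_slice[OF op op'] \<xi> by blast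
    then show "\<xi> \<in> Wqf S Vqf"
      using \<xi> by (intro Wqf_of_slices) (auto simp: frakE_def)
  qed
qed

end
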